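(* Let $\Phi : \mathscr{S} \ni s \mapsto A_s \in \mathscr{L}(X)$ and $\Psi : \mathscr{S} \ni s \mapsto B_s \in \mathscr{L}(Y)$ be two homomorphisms of a strongly [resp. weakly] right amenable SGT $\mathscr{S}$ into $\mathscr{L}(X)$ and $\mathscr{L}(Y)$, where $X$ and $Y$ are Banach spaces. Suppose $T_0 : E \to Y$ is a bounded linear operator from a closed linear subspace $E$ of $X$ into $Y$ and: (i0) $\Phi$ and $\Psi$ are continuous in the strong operator topologies [resp. operator norm topologies] of $\mathscr{L}(X)$ and $\mathscr{L}(Y)$, respectively; (i1) for any $s \in \mathscr{S}$, $A_s(E) \subset E$ and $B_s$ is an isomorphism; (i2) $Y$ is a dual Banach space; (i3) for any $s \in \mathscr{S}$, $B_s$ is weak* continuous on the closed unit ball $B_Y$ of $Y$; (i4) the function $\mathscr{S} \ni s \mapsto \|B_s^{-1}\| \in \mathbb{R}$ is locally bounded; (i5) $B_s T_0 = T_0 A_s|_E$ for any $s \in \mathscr{S}$. Then the following conditions are equivalent: (i) $T_0$ extends to a bounded linear operator $T : X \to Y$ that intertwines $\Phi$ and $\Psi$, that is, $B_s T = T A_s$ for all $s \in \mathscr{S}$; (ii) there exists a bounded linear operator $T' : X \to Y$ that extends $T_0$ and satisfies $\sup_{s \in \mathscr{S}} \|B_s^{-1} T' A_s\| < \infty$. (The statement consists of two versions: "strongly / strong operator topologies" and "weakly / operator norm topologies".)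
   Context: An SGT (semigroup with topology) is a non-empty semigroup $\mathscr{S}$ that is also a (possibly non-Hausdorff) topological space; no compatibility between the multiplication and the topology is assumed. For $f:\mathscr{S}\to\mathbb{R}$ and $s\in\mathscr{S}$ let $f_s(t)=f(ts)$. $C_b(\mathscr{S})$ is the space of bounded continuous real-valued functions on $\mathscr{S}$ with the sup-norm, and $C_r(\mathscr{S})=\{f\in C_b(\mathscr{S}): f_s \text{ is continuous for every } s\in\mathscr{S}\}$. Let $C_{norm}(\mathscr{S})$ [resp. $C_{weak}(\mathscr{S})$] be the set of all $f\in C_r(\mathscr{S})$ such that $s\mapsto f_s$ and, for all $t\in\mathscr{S}$, $s\mapsto f_{st}$ are continuous from $\mathscr{S}$ to $C_r(\mathscr{S})$ equipped with its norm [resp. weak] topology. A mean on a linear subspace $\mathscr{F}$ of $C_r(\mathscr{S})$ is a linear functional $\phi:\mathscr{F}\to\mathbb{R}$ with $\inf f(\mathscr{S})\leqslant\phi(f)\leqslant\sup f(\mathscr{S})$ for all $f\in\mathscr{F}$; if $\mathscr{F}$ is right invariant ($f_s\in\mathscr{F}$ for $f\in\mathscr{F}$, $s\in\mathscr{S}$), the mean is right invariant if $\phi(f_s)=\phi(f)$ for all $f\in\mathscr{F}$, $s\in\mathscr{S}$. $\mathscr{S}$ is weakly [resp. strongly] right amenable if there is a right invariant mean on $C_{norm}(\mathscr{S})$ [resp. $C_{weak}(\mathscr{S})$]. Banach spaces are real or complex. $\mathscr{L}(X)$ is the algebra of bounded linear operators on $X$; $s\mapsto T_s$ is a homomorphism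 if $T_{st}=T_sT_t$ for all $s,t$. A dual Banach space is a Banach space linearly isometric to the dual of some Banach space; its weak* topology comes from this (fixed) identification. "$B_s$ is an isomorphism" means it is a bounded linear bijection of $Y$ with bounded inverse. *)

theory Defs
  imports "HOL-Analysis.Analysis"
begin

section \<open>Real and complex scalars\<close>

text \<open>
  Up to isomorphism of normed fields, the members of this class are exactly the real and
  the complex numbers: the first disjunct says that there are no scalars but the real ones,
  the second one that the field is obtained by adjoining a square root of \<open>-1\<close> and carries
  the usual modulus.
\<close>

class real_or_complex = real_normed_field +
  assumes real_or_complex:
    "(\<forall>z. \<exists>a. z = a *\<^sub>R 1) \<or>
     (\<exists>i. i * i = - 1 \<and>
        (\<forall>z. \<exists>a b. z = a *\<^sub>R 1 + b *\<^sub>R i \<and> norm z = sqrt (a\<^sup>2 + b\<^sup>2)))"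

instance real :: real_or_complex
  by standard (auto intro: exI[where x = "_ :: real"])

instance complex :: real_or_complex
proof
  have "\<exists>a b. z = a *\<^sub>R 1 + b *\<^sub>R \<i> \<and> norm z = sqrt (a\<^sup>2 + b\<^sup>2)" for z :: complex
    by (rule exI[of _ "Re z"], rule exI[of _ "Im z"])
       (simp add: complex_eq_iff cmod_def)
  then show "(\<forall>z::complex. \<exists>a. z = a *\<^sub>R 1) \<or>
     (\<exists>i::complex. i * i = - 1 \<and>
        (\<forall>z. \<exists>a b. z = a *\<^sub>R 1 + b *\<^sub>R i \<and> norm z = sqrt (a\<^sup>2 + b\<^sup>2)))"
    by (intro disjI2 exI[of _ \<i>]) simp
qed


section \<open>Banach spaces and their operators\<close>

text \<open>
  The library class \<open>banach\<close> consists of real Banach spaces. A Banach space over \<open>'k\<close> is a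
  type of this class with a scalar multiplication \<open>sc\<close> by \<open>'k\<close> that extends \<open>scaleR\<close> and is
  compatible with the norm. For \<open>'k = real\<close> this forces \<open>sc = scaleR\<close>.
\<close>

definition banach_space_over :: "('k::real_or_complex \<Rightarrow> 'x::banach \<Rightarrow> 'x) \<Rightarrow> bool" where
  "banach_space_over sc \<longleftrightarrow>
     vector_space sc \<and>
     (\<forall>r x. sc (of_real r) x = r *\<^sub>R x) \<and>
     (\<forall>c x. norm (sc c x) = norm c * norm x)"

text \<open>
  Elements of the type \<open>'x \<Rightarrow>\<^sub>L 'y\<close> are only real-linear, hence the requirement of linearity
  over \<open>'k\<close>. The norm, the norm topology and the strong operator topology are those of
  \<open>'x \<Rightarrow>\<^sub>L 'y\<close>.
\<close>

definition bounded_operators ::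
    "('k::real_or_complex \<Rightarrow> 'x::real_normed_vector \<Rightarrow> 'x) \<Rightarrow>
     ('k \<Rightarrow> 'y::real_normed_vector \<Rightarrow> 'y) \<Rightarrow> ('x \<Rightarrow>\<^sub>L 'y) set" where
  "bounded_operators scX scY = {T. Vector_Spaces.linear scX scY (blinfun_apply T)}"

text \<open>For maps given on a subspace \<open>E\<close>; their values outside of \<open>E\<close> are irrelevant.\<close>

definition bounded_linear_on ::
    "'x set \<Rightarrow> ('k \<Rightarrow> 'x::real_normed_vector \<Rightarrow> 'x) \<Rightarrow>
     ('k \<Rightarrow> 'y::real_normed_vector \<Rightarrow> 'y) \<Rightarrow> ('x \<Rightarrow> 'y) \<Rightarrow> bool" where
  "bounded_linear_on E scX scY T \<longleftrightarrow>
     (\<forall>x\<in>E. \<forall>y\<in>E. T (x + y) = T x + T y) \<and>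
     (\<forall>c. \<forall>x\<in>E. T (scX c x) = scY c (T x)) \<and>
     (\<exists>K. \<forall>x\<in>E. norm (T x) \<le> K * norm x)"

definition isomorphism :: "('y::real_normed_vector \<Rightarrow>\<^sub>L 'y) \<Rightarrow> bool" where
  "isomorphism B \<longleftrightarrow>
     bij (blinfun_apply B) \<and> bounded_linear (inv (blinfun_apply B))"

text \<open>Meaningful only if \<open>B\<close> is an isomorphism.\<close>

definition inverse_operator ::
    "('y::real_normed_vector \<Rightarrow>\<^sub>L 'y) \<Rightarrow> ('y \<Rightarrow>\<^sub>L 'y)" where
  "inverse_operator B = Blinfun (inv (blinfun_apply B))"

lemma inverse_operator_apply:
  assumes "isomorphism B"
  shows "blinfun_apply (inverse_operator B) = inv (blinfun_apply B)"
  using assms by (simp add: isomorphism_def inverse_operator_def bounded_linear_Blinfun_apply)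

text \<open>
  \<open>J\<close> is a linear isometry of \<open>Y\<close> onto the dual of the Banach space \<open>Z\<close>.
\<close>

definition dual_identification ::
    "('k::real_or_complex \<Rightarrow> 'y::banach \<Rightarrow> 'y) \<Rightarrow> ('k \<Rightarrow> 'z::banach \<Rightarrow> 'z) \<Rightarrow>
     ('y \<Rightarrow> ('z \<Rightarrow>\<^sub>L 'k)) \<Rightarrow> bool" where
  "dual_identification scY scZ J \<longleftrightarrow>
     (\<forall>z. Vector_Spaces.linear scY (*) (\<lambda>y. blinfun_apply (J y) z)) \<and>
     (\<forall>y. norm (J y) = norm y) \<and>
     range J = bounded_operators scZ (*)"

text \<open>
  On the dual of \<open>Z\<close> the strong operator topology is the topology of pointwise convergence
  on \<open>Z\<close>, that is, the weak* topology.
\<close>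

definition weak_star_topology ::
    "('y \<Rightarrow> ('z::real_normed_vector \<Rightarrow>\<^sub>L 'k::real_normed_vector)) \<Rightarrow> 'y topology" where
  "weak_star_topology J = pullback_topology UNIV J strong_operator_topology"

text \<open>
  The weak topology of a linear subspace \<open>V\<close> of a real normed space: the coarsest topology
  on \<open>V\<close> for which all bounded linear functionals of \<open>V\<close> are continuous.
\<close>

definition weak_topology_on :: "'v::real_normed_vector set \<Rightarrow> 'v topology" where
  "weak_topology_on V =
     topology_generated_by
       {{f \<in> V. \<mu> f \<in> U} | \<mu> U. bounded_linear_on V scaleR scaleR \<mu> \<and> open (U::real set)}"

lemma topspace_weak_topology_on: "topspace (weak_topology_on V) = V"
proof -
  have "bounded_linear_on V scaleR scaleR (\<lambda>_. 0::real)"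
    by (auto simp: bounded_linear_on_def intro: exI[of _ 0])
  then have "{f \<in> V. (0::real) \<in> UNIV} \<in>
      {{f \<in> V. \<mu> f \<in> U} | \<mu> U. bounded_linear_on V scaleR scaleR \<mu> \<and> open (U::real set)}"
    by blast
  then show ?thesis
    unfolding weak_topology_on_def topology_generated_by_topspace by auto
qed


section \<open>Semigroups with topology\<close>

text \<open>
  A semigroup with topology is a type of the classes \<open>semigroup_mult\<close> and
  \<open>topological_space\<close>; neither the Hausdorff property nor any continuity of the
  multiplication is assumed.
\<close>

definition C_r :: "('s::{semigroup_mult, topological_space} \<Rightarrow>\<^sub>C real) set" where
  "C_r = {f. \<forall>s. continuous_on UNIV (\<lambda>t. apply_bcontfun f (t * s))}"

text \<open>
  The translate \<open>f\<^sub>s\<close>. It is meaningful for \<open>f \<in> C_r\<close> only, since otherwise the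
  function passed to \<open>Bcontfun\<close> need not be continuous.
\<close>

definition translate ::
    "('s::{semigroup_mult, topological_space} \<Rightarrow>\<^sub>C real) \<Rightarrow> 's \<Rightarrow> ('s \<Rightarrow>\<^sub>C real)" where
  "translate f s = Bcontfun (\<lambda>t. apply_bcontfun f (t * s))"

lemma translate_apply:
  assumes "f \<in> C_r"
  shows "apply_bcontfun (translate f s) t = apply_bcontfun f (t * s)"
proof -
  have "(\<lambda>t. apply_bcontfun f (t * s)) \<in> bcontfun"
    using assms norm_bounded[of f]
    by (intro bcontfun_normI[where b = "norm f"]) (auto simp: C_r_def)
  then show ?thesis
    by (simp add: translate_def Bcontfun_inverse)
qed

lemma translate_in_C_r:
  assumes "f \<in> C_r"
  shows "translate f s \<in> C_r"
  using assms by (auto simp: C_r_def translate_apply[OF assms] mult.assoc)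

lemma translate_translate:
  assumes "f \<in> C_r"
  shows "translate (translate f s) = (\<lambda>t. translate f (t * s))"
  by (intro ext bcontfun_eqI)
     (simp add: translate_apply assms translate_in_C_r mult.assoc)

definition C_norm :: "('s::{semigroup_mult, topological_space} \<Rightarrow>\<^sub>C real) set" where
  "C_norm = {f \<in> C_r.
     continuous_on UNIV (\<lambda>s. translate f s) \<and>
     (\<forall>t. continuous_on UNIV (\<lambda>s. translate f (s * t)))}"

definition C_weak :: "('s::{semigroup_mult, topological_space} \<Rightarrow>\<^sub>C real) set" where
  "C_weak = {f \<in> C_r.
     continuous_map euclidean (weak_topology_on C_r) (\<lambda>s. translate f s) \<and>
     (\<forall>t. continuous_map euclidean (weak_topology_on C_r) (\<lambda>s. translate f (s * t)))}"

definition right_invariant_space ::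
    "('s::{semigroup_mult, topological_space} \<Rightarrow>\<^sub>C real) set \<Rightarrow> bool" where
  "right_invariant_space F \<longleftrightarrow> (\<forall>f\<in>F. \<forall>s. translate f s \<in> F)"

lemma right_invariant_C_norm: "right_invariant_space C_norm"
  by (auto simp: right_invariant_space_def C_norm_def translate_in_C_r translate_translate
      mult.assoc)

lemma right_invariant_C_weak: "right_invariant_space C_weak"
  by (auto simp: right_invariant_space_def C_weak_def translate_in_C_r translate_translate
      mult.assoc)

definition mean_on ::
    "('s::{semigroup_mult, topological_space} \<Rightarrow>\<^sub>C real) set \<Rightarrow>
     (('s \<Rightarrow>\<^sub>C real) \<Rightarrow> real) \<Rightarrow> bool" where
  "mean_on F \<phi> \<longleftrightarrow>
     (\<forall>f\<in>F. \<forall>g\<in>F. \<phi> (f + g) = \<phi> f + \<phi> g) \<and>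
     (\<forall>c. \<forall>f\<in>F. \<phi> (c *\<^sub>R f) = c * \<phi> f) \<and>
     (\<forall>f\<in>F. Inf (range (apply_bcontfun f)) \<le> \<phi> f \<and> \<phi> f \<le> Sup (range (apply_bcontfun f)))"

definition right_invariant_mean_on ::
    "('s::{semigroup_mult, topological_space} \<Rightarrow>\<^sub>C real) set \<Rightarrow>
     (('s \<Rightarrow>\<^sub>C real) \<Rightarrow> real) \<Rightarrow> bool" where
  "right_invariant_mean_on F \<phi> \<longleftrightarrow>
     mean_on F \<phi> \<and> (\<forall>f\<in>F. \<forall>s. \<phi> (translate f s) = \<phi> f)"

definition weakly_right_amenable ::
    "'s::{semigroup_mult, topological_space} itself \<Rightarrow> bool" where
  "weakly_right_amenable TYPE('s) \<longleftrightarrow>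
     (\<exists>\<phi>. right_invariant_mean_on (C_norm :: ('s \<Rightarrow>\<^sub>C real) set) \<phi>)"

definition strongly_right_amenable ::
    "'s::{semigroup_mult, topological_space} itself \<Rightarrow> bool" where
  "strongly_right_amenable TYPE('s) \<longleftrightarrow>
     (\<exists>\<phi>. right_invariant_mean_on (C_weak :: ('s \<Rightarrow>\<^sub>C real) set) \<phi>)"

definition locally_bounded :: "('s::topological_space \<Rightarrow> real) \<Rightarrow> bool" where
  "locally_bounded h \<longleftrightarrow> (\<forall>s. \<exists>U. open U \<and> s \<in> U \<and> bounded (h ` U))"

definition operator_homomorphism ::
    "('s::semigroup_mult \<Rightarrow> ('x::real_normed_vector \<Rightarrow>\<^sub>L 'x)) \<Rightarrow> bool" where
  "operator_homomorphism A \<longleftrightarrow> (\<forall>s t. A (s * t) = A s o\<^sub>L A t)"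

end

theory Submission
  imports Defs
begin

text \<open>
  If \<open>T\<close> intertwines \<open>A\<close> and \<open>B\<close>, then \<open>B\<^sub>s\<inverse> T A\<^sub>s = T\<close> for all \<open>s\<close>, so \<open>T\<close> itself
  is a bounded extension with bounded conjugates. Conversely, let \<open>T'\<close> be such an extension,
  put \<open>G\<^sub>s = B\<^sub>s\<inverse> T' A\<^sub>s\<close>, and
  average these operators over \<open>s\<close> with the invariant mean \<open>\<phi>\<close>: with
  \<open>\<langle>y, z\<rangle> = Re ((J y) z)\<close> the average \<open>T\<close> is defined by \<open>\<langle>T x, z\<rangle> = \<phi> (s \<mapsto> \<langle>G\<^sub>s x, z\<rangle>)\<close>,
  which makes sense because \<open>Y\<close> is a dual space and the orbit \<open>s \<mapsto> G\<^sub>s x\<close> is bounded. On \<open>E\<close>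
  the orbit is constant with value \<open>T\<^sub>0 x\<close>, so \<open>T\<close> extends \<open>T\<^sub>0\<close>. The identity
  \<open>G\<^sub>s A\<^sub>t = B\<^sub>t G\<^sub>s\<^sub>t\<close> turns the invariance of \<open>\<phi>\<close> into \<open>T A\<^sub>t = B\<^sub>t T\<close>, as soon as \<open>B\<^sub>t\<close> may
  be interchanged with the averaging and the functions \<open>s \<mapsto> \<langle>G\<^sub>s x, z\<rangle>\<close> are in the domain of
  \<open>\<phi>\<close>.

  The interchange is \<open>weak_star_integral_commutes\<close>. By the elementary separation argument
  of \<open>convex_functional_approximation\<close>, finitely
  many values of a bounded functional \<open>\<mu>\<close> are approximated by values at a point of an
  absolutely convex hull of the orbit. These points stay in a fixed ball, where \<open>B\<^sub>t\<close> is weak*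
  continuous.

  The membership in the domain depends on the version. If \<open>B\<close> is norm continuous, so is
  \<open>s \<mapsto> B\<^sub>s\<inverse>\<close> by local boundedness of the inverses, and the translates
  \<open>r \<mapsto> \<langle>B\<^sub>s\<inverse> G\<^sub>r A\<^sub>s x, z\<rangle>\<close> depend on \<open>s\<close> continuously in the sup-norm. If \<open>A\<close> and \<open>B\<close> are only
  strongly continuous, a bounded functional \<open>\<mu>\<close> has to be applied to these translates. The
  interchange property, now for \<open>\<mu>\<close> in place of the mean, gives the value
  \<open>\<langle>B\<^sub>s\<inverse> I A\<^sub>s x, z\<rangle>\<close>, where \<open>I\<close> is the average of the operators \<open>G\<^sub>r\<close> with respect to \<open>\<mu>\<close>, and
  this is continuous in \<open>s\<close>. So one lemma, \<open>averaged_operator_translate\<close>, serves for both the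
  membership in \<open>C_weak\<close> and the final intertwining relation.
\<close>

section \<open>Approximation by points of a convex set\<close>

text \<open>
  Unless a combination of the functionals \<open>l i - c i\<close> is strictly positive on \<open>K\<close>, the vector
  \<open>c\<close> is in the closure of the image of \<open>K\<close> under all \<open>l i\<close>. This is the separation theorem in
  finite dimension; the proof takes a point that almost minimises the Euclidean distance from
  \<open>c\<close>, uses its error vector as the coefficients of a combination, and moves towards a point
  at which this combination is nonpositive.
\<close>

lemma convex_functional_approximation:
  fixes l :: "'i \<Rightarrow> 'y::real_vector \<Rightarrow> real" and c :: "'i \<Rightarrow> real"
  assumes "finite I" and K: "convex K" "K \<noteq> {}"
    and lin: "\<And>i. i \<in> I \<Longrightarrow> linear (l i)"
    and bound: "\<And>i y. i \<in> I \<Longrightarrow> y \<in> K \<Longrightarrow> \<bar>l i y\<bar> \<le> C i"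
    and unseparated: "\<And>a. \<exists>y\<in>K. (\<Sum>i\<in>I. a i * (l i y - c i)) \<le> 0"
    and "e > 0"
  obtains y where "y \<in> K" "\<And>i. i \<in> I \<Longrightarrow> \<bar>l i y - c i\<bar> < e"
proof -
  define v where "v i y = l i y - c i" for i y
  define q where "q y = (\<Sum>i\<in>I. (v i y)\<^sup>2)" for y
  define D where "D = Inf (q ` K)"
  define Q where "Q = (\<Sum>i\<in>I. (C i + \<bar>c i\<bar>)\<^sup>2)"
  have q_nonneg: "0 \<le> q y" for y
    by (simp add: q_def sum_nonneg)
  then have bdd: "bdd_below (q ` K)"
    by (auto intro: bdd_belowI[of _ 0])
  have D_le: "D \<le> q y" if "y \<in> K" for y
    unfolding D_def using bdd that by (auto intro: cInf_lower)
  have q_le: "q y \<le> Q" if "y \<in> K" for y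
    unfolding q_def Q_def
  proof (rule sum_mono)
    fix i assume "i \<in> I"
    then have "\<bar>l i y - c i\<bar> \<le> \<bar>C i + \<bar>c i\<bar>\<bar>"
      using bound[OF \<open>i \<in> I\<close> that] by linarith
    then show "(v i y)\<^sup>2 \<le> (C i + \<bar>c i\<bar>)\<^sup>2"
      unfolding v_def by (rule abs_le_square_iff[THEN iffD1])
  qed
  have "D \<ge> 0"
    unfolding D_def using K q_nonneg by (auto intro: cInf_greatest)
  have "D = 0"
  proof (rule ccontr)
    assume "D \<noteq> 0"
    with \<open>D \<ge> 0\<close> have "D > 0" by simp
    obtain y0 where "y0 \<in> K" using K by auto
    with D_le[of y0] q_le[of y0] have "D \<le> Q" by simp
    with \<open>D > 0\<close> have "Q > 0" by simp
    \<comment> \<open>This \<open>r\<close> minimises \<open>D - r * D + r\<^sup>2 * Q\<close>, the bound for \<open>q\<close> after a step of width \<open>r\<close>.\<close>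
    define r where "r = D / (2 * Q)"
    have r: "0 < r" "r \<le> 1"
      using \<open>D > 0\<close> \<open>Q > 0\<close> \<open>D \<le> Q\<close> by (auto simp: r_def field_simps)
    have "Inf (q ` K) < D + r * D"
      using \<open>D > 0\<close> r by (simp add: D_def)
    then obtain y where y: "y \<in> K" "q y < D + r * D"
      using cInf_lessD[of "q ` K"] K by auto
    obtain y' where y': "y' \<in> K" "(\<Sum>i\<in>I. v i y * v i y') \<le> 0"
      using unseparated[of "\<lambda>i. v i y"] by (auto simp: v_def)
    define p where "p = (1 - r) *\<^sub>R y + r *\<^sub>R y'"
    have "p \<in> K"
      unfolding p_def using K(1) y(1) y'(1) r by (auto simp: convex_alt)
    have v_p: "v i p = (1 - r) * v i y + r * v i y'" if "i \<in> I" for i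
      unfolding v_def p_def linear_add[OF lin[OF that]] linear_scale[OF lin[OF that]]
      by (simp add: algebra_simps)
    have "q p = (\<Sum>i\<in>I. (1 - r)\<^sup>2 * (v i y)\<^sup>2 + 2 * r * (1 - r) * (v i y * v i y')
        + r\<^sup>2 * (v i y')\<^sup>2)"
      unfolding q_def
      by (rule sum.cong) (auto simp: v_p power2_eq_square algebra_simps)
    also have "\<dots> = (1 - r)\<^sup>2 * q y + 2 * r * (1 - r) * (\<Sum>i\<in>I. v i y * v i y') + r\<^sup>2 * q y'"
      by (simp add: q_def sum.distrib sum_distrib_left)
    also have "\<dots> \<le> (1 - r)\<^sup>2 * q y + 0 + r\<^sup>2 * Q"
      using y'(2) r q_le[OF y'(1)]
      by (intro add_mono mult_left_mono) (auto intro!: mult_nonneg_nonpos)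
    also have "\<dots> \<le> (1 - r)\<^sup>2 * (D + r * D) + r\<^sup>2 * Q"
      unfolding add_0_right
      by (intro add_right_mono mult_left_mono less_imp_le[OF y(2)] zero_le_power2)
    also have "\<dots> = (1 - r) * D * (1 - r\<^sup>2) + r * (r * Q)"
      by (simp add: power2_eq_square algebra_simps)
    also have "\<dots> \<le> (1 - r) * D + r * (D / 2)"
      using r \<open>D > 0\<close> \<open>Q > 0\<close> by (intro add_mono mult_left_le) (auto simp: r_def)
    finally have "D \<le> D - r * D / 2"
      using D_le[OF \<open>p \<in> K\<close>] by (simp add: algebra_simps)
    then show False using mult_pos_pos[OF r(1) \<open>D > 0\<close>] by simp
  qed
  then have "Inf (q ` K) < e\<^sup>2"
    using \<open>e > 0\<close> by (simp add: D_def)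
  then obtain y where y: "y \<in> K" "q y < e\<^sup>2"
    using cInf_lessD[of "q ` K"] K by auto
  have "\<bar>v i y\<bar> < e" if "i \<in> I" for i
  proof -
    have "(v i y)\<^sup>2 \<le> q y"
      unfolding q_def using \<open>finite I\<close> that by (intro member_le_sum) auto
    with y(2) have "(v i y)\<^sup>2 < e\<^sup>2" by simp
    then show ?thesis
      using \<open>e > 0\<close> by (intro power2_less_imp_less[of "\<bar>v i y\<bar>"]) auto
  qed
  with y(1) that show ?thesis by (auto simp: v_def)
qed

section \<open>Integrals in a dual space\<close>

lemma bounded_linear_on_sum:
  assumes V: "subspace V" and \<mu>: "bounded_linear_on V scaleR scaleR \<mu>"
    and "finite I" and F: "\<And>i. i \<in> I \<Longrightarrow> F i \<in> V"
  shows "\<mu> (\<Sum>i\<in>I. a i *\<^sub>R F i) = (\<Sum>i\<in>I. a i *\<^sub>R \<mu> (F i))"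
  using \<open>finite I\<close> F
proof (induction I)
  case empty
  have "\<mu> (0 *\<^sub>R 0) = 0 *\<^sub>R \<mu> 0"
    using \<mu> subspace_0[OF V] unfolding bounded_linear_on_def by blast
  then show ?case by simp
next
  case (insert i I)
  then have "a i *\<^sub>R F i \<in> V" "(\<Sum>i\<in>I. a i *\<^sub>R F i) \<in> V" "F i \<in> V"
    using V by (auto intro: subspace_scale subspace_sum)
  with insert \<mu> show ?case
    by (simp add: bounded_linear_on_def)
qed

lemma bounded_linear_on_bound:
  fixes V :: "'a::real_normed_vector set"
  assumes "bounded_linear_on V scX scY \<mu>"
  obtains N where "N \<ge> 0" "\<And>f. f \<in> V \<Longrightarrow> norm (\<mu> f) \<le> N * norm f"
proof -
  obtain N where N: "\<And>f. f \<in> V \<Longrightarrow> norm (\<mu> f) \<le> N * norm f"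
    using assms unfolding bounded_linear_on_def by blast
  have "norm (\<mu> f) \<le> \<bar>N\<bar> * norm f" if "f \<in> V" for f
    using N[OF that] by (smt (verit) mult_right_mono norm_ge_zero)
  then show ?thesis by (intro that[of "\<bar>N\<bar>"]) auto
qed

text \<open>
  Weak* continuity at \<open>0\<close> relative to the unit ball, in terms of a real pairing. For a linear map
  it amounts to weak* continuity on every ball, by translation and scaling.
\<close>

definition weak_star_continuous_on_ball ::
    "('y::real_normed_vector \<Rightarrow> 'z::real_normed_vector \<Rightarrow> real) \<Rightarrow> ('y \<Rightarrow> 'y) \<Rightarrow> bool" where
  "weak_star_continuous_on_ball pair B \<longleftrightarrow>
     (\<forall>z. \<forall>e>0. \<exists>W d. finite W \<and> d > 0 \<and>
        (\<forall>y. norm y \<le> 1 \<longrightarrow> (\<forall>w\<in>W. \<bar>pair y w\<bar> < d) \<longrightarrow> \<bar>pair (B y) z\<bar> < e))"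

text \<open>
  The real structure that remains of an identification of \<open>'y\<close> with a dual space of \<open>'z\<close>,
  over either scalar field: the norm of \<open>'y\<close> is the dual norm, and every bounded real-linear
  functional on \<open>'z\<close> comes from an element of \<open>'y\<close>.
\<close>

locale predual_pairing =
  fixes pair :: "'y::real_normed_vector \<Rightarrow> 'z::real_normed_vector \<Rightarrow> real"
  assumes pair_bilinear: "bounded_bilinear pair"
    and pair_le: "\<bar>pair y z\<bar> \<le> norm y * norm z"
    and pair_norm_le: "0 \<le> K \<Longrightarrow> (\<And>z. pair y z \<le> K * norm z) \<Longrightarrow> norm y \<le> K"
    and pair_represents: "bounded_linear h \<Longrightarrow> \<exists>y. \<forall>z. pair y z = h z"
begin

sublocale pair: bounded_bilinear pair
  by (rule pair_bilinear)

lemma pair_separates: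
  assumes "\<And>z. pair y z = pair y' z"
  shows "y = y'"
proof -
  have "norm (y - y') \<le> 0"
    by (rule pair_norm_le) (auto simp: pair.diff_left assms)
  then show ?thesis by simp
qed

lemma weak_star_continuous_on_ball_radius:
  assumes B: "weak_star_continuous_on_ball pair B" "linear B" and "e > 0" "R > 0"
  obtains W d where "finite W" "d > 0"
    "\<And>y. norm y \<le> R \<Longrightarrow> (\<And>w. w \<in> W \<Longrightarrow> \<bar>pair y w\<bar> < d) \<Longrightarrow> \<bar>pair (B y) z\<bar> < e"
proof -
  have "e / R > 0" using assms by simp
  then obtain W d where W: "finite W" "d > 0"
    "\<And>y. norm y \<le> 1 \<Longrightarrow> (\<And>w. w \<in> W \<Longrightarrow> \<bar>pair y w\<bar> < d) \<Longrightarrow> \<bar>pair (B y) z\<bar> < e / R"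
    using B(1) unfolding weak_star_continuous_on_ball_def by meson
  have "\<bar>pair (B y) z\<bar> < e" if "norm y \<le> R" "\<And>w. w \<in> W \<Longrightarrow> \<bar>pair y w\<bar> < d * R" for y
  proof -
    have "\<bar>pair (B ((1 / R) *\<^sub>R y)) z\<bar> < e / R"
      using that \<open>R > 0\<close>
      by (intro W(3)) (auto simp: pair.scaleR_left field_simps abs_divide)
    then show ?thesis
      using \<open>R > 0\<close> B(2) by (auto simp: linear_scale pair.scaleR_left field_simps abs_divide)
  qed
  with W(1,2) \<open>R > 0\<close> show ?thesis by (intro that[of W "d * R"]) auto
qed

text \<open>
  The weak* integral of a bounded function \<open>g\<close> with respect to a functional \<open>\<mu>\<close> exists because
  \<open>w \<mapsto> \<mu> \<langle>g, w\<rangle>\<close> is a bounded functional on the predual.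
\<close>

lemma weak_star_integral:
  fixes V :: "('s::topological_space \<Rightarrow>\<^sub>C real) set" and g :: "'s \<Rightarrow> 'y"
  assumes \<mu>: "bounded_linear_on V scaleR scaleR \<mu>"
    and N: "N \<ge> 0" "\<And>f. f \<in> V \<Longrightarrow> norm (\<mu> f) \<le> N * norm f"
    and g: "\<And>s. norm (g s) \<le> R"
    and f: "\<And>w. f w \<in> V" "\<And>w s. apply_bcontfun (f w) s = pair (g s) w"
  obtains y where "norm y \<le> N * R" "\<And>w. pair y w = \<mu> (f w)"
proof -
  have "R \<ge> 0" using g[of undefined] norm_ge_zero order_trans by blast
  have bound: "\<bar>\<mu> (f w)\<bar> \<le> N * R * norm w" for w
  proof -
    have "norm (f w) \<le> R * norm w"
    proof (rule norm_bound)
      fix s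
      have "norm (apply_bcontfun (f w) s) \<le> norm (g s) * norm w"
        using pair_le by (simp add: f(2))
      also have "\<dots> \<le> R * norm w"
        using g by (rule mult_right_mono) simp
      finally show "norm (apply_bcontfun (f w) s) \<le> R * norm w" .
    qed
    then have "N * norm (f w) \<le> N * (R * norm w)"
      using N(1) by (rule mult_left_mono)
    then show ?thesis
      using N(2)[OF f(1), of w] by (simp add: mult_ac)
  qed
  have "f (w + w') = f w + f w'" "f (r *\<^sub>R w) = r *\<^sub>R f w" for w w' r
    by (rule bcontfun_eqI; simp add: f(2) pair.add_right pair.scaleR_right)+
  then have "\<mu> (f (w + w')) = \<mu> (f w) + \<mu> (f w')" "\<mu> (f (r *\<^sub>R w)) = r *\<^sub>R \<mu> (f w)" for w w' r
    using \<mu> f(1) by (simp_all add: bounded_linear_on_def)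
  then have "bounded_linear (\<lambda>w. \<mu> (f w))"
    using bound by (intro bounded_linear_intro[of _ "N * R"]) (auto simp: mult_ac)
  then obtain y where y: "\<And>w. pair y w = \<mu> (f w)"
    using pair_represents by blast
  have "norm y \<le> N * R"
    using N(1) \<open>R \<ge> 0\<close> bound by (intro pair_norm_le) (auto simp: y abs_le_iff)
  then show ?thesis using y by (rule that)
qed

text \<open>
  A weak* limit argument for \<open>\<mu> \<langle>B g, z\<rangle> = \<langle>B y, z\<rangle>\<close>: the values of \<open>\<mu>\<close> at \<open>\<langle>B g, z\<rangle>\<close> and at
  finitely many functions \<open>\<langle>g, w\<rangle>\<close> are approximated by \<open>\<langle>B x, z\<rangle>\<close> and \<open>\<langle>x, w\<rangle>\<close> for a common
  point \<open>x\<close>. Here \<open>x\<close> ranges over an absolutely convex set that is bounded, so that \<open>x - y\<close> is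
  small in the weak* sense and \<open>B\<close> is weak* continuous on a ball that contains it.
\<close>

lemma weak_star_integral_commutes:
  fixes V :: "('s::topological_space \<Rightarrow>\<^sub>C real) set" and g :: "'s \<Rightarrow> 'y"
  assumes V: "subspace V" and \<mu>: "bounded_linear_on V scaleR scaleR \<mu>"
    and g: "\<And>s. norm (g s) \<le> R"
    and B: "weak_star_continuous_on_ball pair B" "bounded_linear B"
    and f: "\<And>w. f w \<in> V" "\<And>w s. apply_bcontfun (f w) s = pair (g s) w"
    and f': "\<And>w. f' w \<in> V" "\<And>w s. apply_bcontfun (f' w) s = pair (B (g s)) w"
    and y: "\<And>w. \<mu> (f w) = pair y w" and y': "\<And>w. \<mu> (f' w) = pair y' w"
  shows "B y = y'"
proof (rule pair_separates)
  fix z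
  obtain N' where N': "N' \<ge> 0" "\<And>f. f \<in> V \<Longrightarrow> norm (\<mu> f) \<le> N' * norm f"
    using bounded_linear_on_bound[OF \<mu>] by blast
  \<comment> \<open>A bound strictly above \<open>N'\<close> makes up for the strictness that the supremum over the orbit loses below.\<close>
  define N where "N = N' + 1"
  have "R \<ge> 0" using g[of undefined] norm_ge_zero order_trans by blast
  define K where "K = convex hull (range (\<lambda>s. N *\<^sub>R g s) \<union> range (\<lambda>s. - (N *\<^sub>R g s)))"
  have "norm (g s) * N \<le> R * N" for s
    using g[of s] N'(1) by (intro mult_right_mono) (auto simp: N_def)
  then have K_ball: "K \<subseteq> cball 0 (N * R)"
    unfolding K_def using N'(1)
    by (intro hull_minimal) (auto simp: N_def mult.commute)
  have K_point: "N *\<^sub>R g s \<in> K" "- (N *\<^sub>R g s) \<in> K" for s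
    unfolding K_def by (auto intro: hull_inc)
  \<comment> \<open>The index \<open>None\<close> is for the functional \<open>\<langle>B y, z\<rangle>\<close>, and \<open>Some w\<close> for \<open>\<langle>y, w\<rangle>\<close>.\<close>
  define l where "l i = (case i of None \<Rightarrow> (\<lambda>y. pair (B y) z) | Some w \<Rightarrow> (\<lambda>y. pair y w))" for i
  define F where "F i = (case i of None \<Rightarrow> f' z | Some w \<Rightarrow> f w)" for i
  have F: "F i \<in> V" "apply_bcontfun (F i) s = l i (g s)" for i s
    by (cases i; simp add: F_def l_def f f')+
  have bl: "bounded_linear (l i)" for i
    by (cases i)
      (auto simp: l_def intro: B(2) pair.bounded_linear_left
        bounded_linear_compose[OF pair.bounded_linear_left])
  then have lin: "linear (l i)" for i
    by (rule bounded_linear.linear)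
  have linB: "linear B"
    using B(2) by (rule bounded_linear.linear)
  have bound: "\<bar>l i x\<bar> \<le> onorm (l i) * (N * R)" if "x \<in> K" for i x
  proof -
    have "\<bar>l i x\<bar> \<le> onorm (l i) * norm x"
      using onorm[OF bl[of i], of x] by simp
    also have "\<dots> \<le> onorm (l i) * (N * R)"
      using that K_ball onorm_pos_le[OF bl] by (intro mult_left_mono) auto
    finally show ?thesis .
  qed
  have "\<bar>pair (B y) z - pair y' z\<bar> < e" if "e > 0" for e
  proof -
    define R' where "R' = N * R + norm y + 1"
    have "R' > 0" using \<open>R \<ge> 0\<close> N'(1) by (auto simp: R'_def N_def intro!: add_nonneg_pos)
    then obtain W d where W: "finite W" "d > 0"
      "\<And>y. norm y \<le> R' \<Longrightarrow> (\<And>w. w \<in> W \<Longrightarrow> \<bar>pair y w\<bar> < d) \<Longrightarrow> \<bar>pair (B y) z\<bar> < e / 2"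
      using weak_star_continuous_on_ball_radius[OF B(1) linB, of "e / 2" R'] \<open>e > 0\<close> by (metis half_gt_zero)
    define I where "I = insert None (Some ` W)"
    have "finite I" using W by (simp add: I_def)
    have unseparated: "\<exists>x\<in>K. (\<Sum>i\<in>I. a i * (l i x - \<mu> (F i))) \<le> 0" for a
    proof (rule ccontr)
      assume "\<not> ?thesis"
      then have pos: "(\<Sum>i\<in>I. a i * (l i x - \<mu> (F i))) > 0" if "x \<in> K" for x
        using that by force
      define H where "H = (\<Sum>i\<in>I. a i *\<^sub>R F i)"
      have "H \<in> V"
        unfolding H_def using F V by (auto intro: subspace_sum subspace_scale)
      have \<mu>_H: "\<mu> H = (\<Sum>i\<in>I. a i * \<mu> (F i))"
        unfolding H_def using bounded_linear_on_sum[OF V \<mu> \<open>finite I\<close>] F by simp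
      have "apply_bcontfun (\<Sum>i\<in>I. a i *\<^sub>R F i) s = (\<Sum>i\<in>I. a i * l i (g s))" for s
        using \<open>finite I\<close> by (induction I) (auto simp: F)
      then have H_apply: "apply_bcontfun H s = (\<Sum>i\<in>I. a i * l i (g s))" for s
        by (simp add: H_def)
      have "\<mu> H < N * apply_bcontfun H s" "\<mu> H < - (N * apply_bcontfun H s)" for s
        using pos[OF K_point(1)[of s]] pos[OF K_point(2)[of s]]
        by (simp_all add: H_apply \<mu>_H right_diff_distrib sum_subtractf linear_scale[OF lin]
            linear_neg[OF lin] sum_negf sum_distrib_left mult.left_commute)
      then have less: "N * \<bar>apply_bcontfun H s\<bar> < - \<mu> H" for s
        by (smt (verit) minus_mult_minus mult_minus_right)
      have "N > 0" using N'(1) by (simp add: N_def)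
      have "norm H \<le> - \<mu> H / N"
        using less \<open>N > 0\<close> by (intro norm_bound) (simp add: field_simps less_imp_le)
      moreover have "- \<mu> H \<le> N' * norm H"
        using N'(2)[OF \<open>H \<in> V\<close>] by simp
      ultimately have "N * norm H \<le> N' * norm H"
        using \<open>N > 0\<close> by (simp add: field_simps)
      then have "norm H \<le> 0" by (simp add: N_def algebra_simps)
      with \<open>- \<mu> H \<le> N' * norm H\<close> have "- \<mu> H \<le> 0" by simp
      moreover have "0 \<le> N * \<bar>apply_bcontfun H undefined\<bar>"
        using \<open>N > 0\<close> by simp
      ultimately show False using less[of undefined] by linarith
    qed
    obtain x where x: "x \<in> K" "\<And>i. i \<in> I \<Longrightarrow> \<bar>l i x - \<mu> (F i)\<bar> < min d (e / 2)"
      using convex_functional_approximation[OF \<open>finite I\<close> _ _ lin bound unseparated, of "min d (e / 2)"]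
        K_point W(2) \<open>e > 0\<close>
      by (metis K_def convex_convex_hull empty_iff half_gt_zero min_less_iff_conj)
    have "norm x \<le> N * R" using x(1) K_ball by auto
    then have "norm (x - y) \<le> R'"
      using norm_triangle_ineq4[of x y] by (simp add: R'_def)
    moreover have "\<bar>pair (x - y) w\<bar> < d" if "w \<in> W" for w
      using x(2)[of "Some w"] that by (simp add: I_def l_def F_def y pair.diff_left)
    ultimately have "\<bar>pair (B (x - y)) z\<bar> < e / 2" by (rule W(3))
    moreover have "\<bar>pair (B x) z - pair y' z\<bar> < e / 2"
      using x(2)[of None] by (simp add: I_def l_def F_def y')
    ultimately show ?thesis
      using linear_diff[OF linB, of x y] by (simp only: pair.diff_left)
  qed
  then show "pair (B y) z = pair y' z"
    by (metis less_irrefl right_minus_eq zero_less_abs_iff)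
qed

end

section \<open>The real pairing of a dual Banach space\<close>

text \<open>
  The real part, and an element \<open>j\<close> that is the imaginary unit in the complex case and \<open>0\<close> in the
  real case; with this choice both scalar fields can be treated by the same formulas.
\<close>

lemma real_or_complex_real_part:
  obtains re :: "'k::real_or_complex \<Rightarrow> real" and j :: 'k
  where "bounded_linear re" "\<And>c. \<bar>re c\<bar> \<le> norm c" "\<And>r. re (of_real r) = r"
    "\<And>r. re (j * of_real r) = 0" "j = 0 \<or> j * j = - 1"
    "\<And>c. c = of_real (re c) - j * of_real (re (j * c))"
proof -
  consider (real) "\<forall>z::'k. \<exists>a. z = a *\<^sub>R 1"
    | (complex) i :: 'k where "i * i = - 1"
      "\<forall>z. \<exists>a b. z = a *\<^sub>R 1 + b *\<^sub>R i \<and> norm z = sqrt (a\<^sup>2 + b\<^sup>2)"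
    using real_or_complex by metis
  then show ?thesis
  proof cases
    case real
    then obtain re :: "'k \<Rightarrow> real" where re: "\<And>z. z = of_real (re z)"
      unfolding of_real_def by metis
    then have re_of_real: "re (of_real r) = r" for r
      by (metis of_real_eq_iff)
    have "\<bar>re c\<bar> = norm c" for c
      by (metis re norm_of_real)
    moreover have "re (x + y) = re x + re y" for x y
      by (metis re of_real_add of_real_eq_iff)
    moreover have "re (r *\<^sub>R x) = r * re x" for r x
      by (metis re of_real_mult of_real_eq_iff scaleR_conv_of_real)
    ultimately have "bounded_linear re"
      by (intro bounded_linear_intro[of _ 1]) auto
    then show ?thesis
      using \<open>\<And>c. \<bar>re c\<bar> = norm c\<close> re re_of_real re_of_real[of 0]
      by (intro that[of re 0]) auto
  next
    case (complex i)
    then obtain re im :: "'k \<Rightarrow> real" where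
      rep: "\<And>z. z = re z *\<^sub>R 1 + im z *\<^sub>R i" "\<And>z. norm z = sqrt ((re z)\<^sup>2 + (im z)\<^sup>2)"
      by metis
    have not_real: "i \<noteq> of_real r" for r
    proof
      assume "i = of_real r"
      with complex(1) have "of_real (r * r) = (of_real (- 1) :: 'k)" by simp
      then have "r * r = - 1" by (simp only: of_real_eq_iff)
      then show False by (metis not_square_less_zero neg_less_0_iff_less zero_less_one)
    qed
    have unique: "re z = a \<and> im z = b" if "z = a *\<^sub>R 1 + b *\<^sub>R i" for z a b
    proof -
      have eq: "(im z - b) *\<^sub>R i = of_real (a - re z)"
        using rep(1)[of z] that by (simp add: of_real_def algebra_simps)
      have "im z = b"
      proof (rule ccontr)
        assume "im z \<noteq> b"
        then have "i = (1 / (im z - b)) *\<^sub>R ((im z - b) *\<^sub>R i)" by simp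
        also have "\<dots> = of_real ((a - re z) / (im z - b))"
          unfolding eq by (simp add: scaleR_conv_of_real)
        finally show False using not_real by blast
      qed
      with eq have "of_real (a - re z) = (of_real 0 :: 'k)" by simp
      then have "a - re z = 0" by (simp only: of_real_eq_iff)
      with \<open>im z = b\<close> show ?thesis by simp
    qed
    have re_le: "\<bar>re c\<bar> \<le> norm c" for c
      unfolding rep(2) by (rule real_sqrt_ge_abs1)
    have "re (x + y) = re x + re y" for x y
      by (rule unique[of _ _ "im x + im y", THEN conjunct1])
        (subst (1) rep(1)[of x], subst (1) rep(1)[of y], simp add: algebra_simps)
    moreover have "re (r *\<^sub>R x) = r * re x" for r x
      by (rule unique[of _ _ "r * im x", THEN conjunct1])
        (subst (1) rep(1)[of x], simp add: algebra_simps)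
    ultimately have "bounded_linear re"
      using re_le by (intro bounded_linear_intro[of _ 1]) auto
    moreover have "re (of_real r) = r" for r
      using unique[of "of_real r" r 0] by (simp add: of_real_def)
    moreover have "re (i * of_real r) = 0" for r
      using unique[of "i * of_real r" 0 r] by (simp add: scaleR_conv_of_real mult.commute)
    moreover have "c = of_real (re c) - i * of_real (re (i * c))" for c
    proof -
      have "i * c = i * (re c *\<^sub>R 1 + im c *\<^sub>R i)"
        using rep(1)[of c] by simp
      also have "\<dots> = (- im c) *\<^sub>R 1 + re c *\<^sub>R i"
        using complex(1) by (simp add: distrib_left)
      finally have "re (i * c) = - im c"
        using unique by blast
      then show ?thesis
        using rep(1)[of c] by (simp add: scaleR_conv_of_real mult.commute)
    qed
    ultimately show ?thesis
      using complex(1) re_le by (intro that[of re i]) auto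
  qed
qed

lemma openin_weak_star_ball:
  fixes z :: "'z::real_normed_vector" and J :: "'y \<Rightarrow> ('z \<Rightarrow>\<^sub>L 'k::real_normed_vector)"
  shows "openin (weak_star_topology J) {y. norm (blinfun_apply (J y) z) < e}"
proof -
  have "openin strong_operator_topology {f :: 'z \<Rightarrow>\<^sub>L 'k. \<forall>i\<in>{()}. blinfun_apply f z \<in> ball 0 e}"
    by (rule strong_operator_topology_basis) auto
  then show ?thesis
    unfolding weak_star_topology_def
    by (subst openin_pullback_topology) (auto simp: dist_norm)
qed

lemma openin_weak_star_contains_ball:
  fixes J :: "'y \<Rightarrow> ('z::real_normed_vector \<Rightarrow>\<^sub>L 'k::real_normed_vector)"
  assumes "openin (weak_star_topology J) U" "y0 \<in> U" "J y0 = 0"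
  obtains W d where "finite W" "d > 0"
    "\<And>y. (\<And>w. w \<in> W \<Longrightarrow> norm (blinfun_apply (J y) w) < d) \<Longrightarrow> y \<in> U"
proof -
  obtain U1 where U1: "openin strong_operator_topology U1" "U = J -` U1 \<inter> UNIV"
    using assms(1) unfolding weak_star_topology_def by (auto simp: openin_pullback_topology)
  obtain U2 :: "('z \<Rightarrow> 'k) set" where U2: "open U2" "U1 = blinfun_apply -` U2 \<inter> UNIV"
    using U1(1) unfolding strong_operator_topology_def by (auto simp: openin_pullback_topology)
  have "openin (product_topology (\<lambda>i. euclidean) UNIV) U2"
    using U2(1) by (simp add: euclidean_product_topology)
  moreover have "(\<lambda>_. 0) \<in> U2"
    using assms(2,3) U1(2) U2(2) by (auto simp: zero_blinfun.rep_eq)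
  ultimately obtain X where X: "(\<lambda>_. 0) \<in> (\<Pi>\<^sub>E i\<in>UNIV. X i)" "\<And>i. openin euclidean (X i)"
    "finite {i. X i \<noteq> topspace euclidean}" "(\<Pi>\<^sub>E i\<in>UNIV. X i) \<subseteq> U2"
    by (blast dest: product_topology_open_contains_basis)
  define W where "W = {i. X i \<noteq> UNIV}"
  have "\<exists>d>0. ball 0 d \<subseteq> X w" for w
    using X(1,2) by (auto simp: PiE_iff open_contains_ball)
  then obtain r where r: "\<And>w. r w > 0" "\<And>w. ball 0 (r w) \<subseteq> X w" by metis
  define d where "d = Min (insert 1 (r ` W))"
  have "finite W" using X(3) by (simp add: W_def)
  then have "d > 0" "\<And>w. w \<in> W \<Longrightarrow> d \<le> r w"
    using r(1) by (auto simp: d_def)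
  show ?thesis
  proof (rule that[OF \<open>finite W\<close> \<open>d > 0\<close>])
    fix y assume y: "\<And>w. w \<in> W \<Longrightarrow> norm (blinfun_apply (J y) w) < d"
    have "blinfun_apply (J y) w \<in> X w" for w
    proof (cases "w \<in> W")
      case True
      then have "norm (blinfun_apply (J y) w) < r w"
        using y[OF True] \<open>\<And>w. w \<in> W \<Longrightarrow> d \<le> r w\<close>[OF True] by linarith
      then show ?thesis using r(2)[of w] by (auto simp: subset_iff)
    qed (auto simp: W_def)
    then show "y \<in> U"
      using X(4) U1(2) U2(2) by (auto simp: PiE_iff)
  qed
qed

text \<open>
  Taking real parts loses nothing: a real-linear functional \<open>h\<close> is the real part of the
  linear functional \<open>z \<mapsto> h z - j h (j z)\<close>, and the norm of \<open>J y\<close> is recovered from its real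
  part by rotating the argument. Likewise \<open>norm c\<close> is controlled by the real parts of \<open>c\<close> and
  \<open>j c\<close>, so a weak* neighbourhood given by finitely many points \<open>w\<close> contains one that is given by
  the real pairing with the points \<open>w\<close> and \<open>j w\<close>.
\<close>

lemma dual_identification_pairing:
  fixes scY :: "'k::real_or_complex \<Rightarrow> 'y::banach \<Rightarrow> 'y"
    and scZ :: "'k \<Rightarrow> 'z::banach \<Rightarrow> 'z"
  assumes Y: "banach_space_over scY" and Z: "banach_space_over scZ"
    and J: "dual_identification scY scZ J"
  obtains pair where "predual_pairing pair"
    "\<And>c y z. pair (scY c y) z = pair y (scZ c z)"
    "\<And>B. linear B \<Longrightarrow> continuous_map (subtopology (weak_star_topology J) (cball 0 1))
        (weak_star_topology J) B \<Longrightarrow> weak_star_continuous_on_ball pair B"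
proof -
  obtain re :: "'k \<Rightarrow> real" and j :: 'k
    where re: "bounded_linear re" "\<And>c. \<bar>re c\<bar> \<le> norm c" "\<And>r. re (of_real r) = r"
      "\<And>r. re (j * of_real r) = 0" "j = 0 \<or> j * j = - 1"
      "\<And>c. c = of_real (re c) - j * of_real (re (j * c))"
    by (rule real_or_complex_real_part) (rule that; assumption)
  interpret re: bounded_linear re by (rule re(1))
  have "norm j \<le> 1"
  proof (cases "j = 0")
    case False
    with re(5) have "norm j * norm j = 1" by (metis norm_minus_cancel norm_mult norm_one)
    then have "\<bar>norm j\<bar> = 1" by (simp only: abs_mult_self_eq flip: abs_square_eq_1 power2_eq_square)
    then show ?thesis by simp
  qed simp
  have norm_le_re: "norm c \<le> \<bar>re c\<bar> + \<bar>re (j * c)\<bar>" for c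
  proof -
    have "norm c \<le> \<bar>re c\<bar> + norm j * \<bar>re (j * c)\<bar>"
      using norm_triangle_ineq4[of "of_real (re c) :: 'k" "j * of_real (re (j * c))"] re(6)[of c]
      by (simp add: norm_mult)
    also have "\<dots> \<le> \<bar>re c\<bar> + \<bar>re (j * c)\<bar>"
      using \<open>norm j \<le> 1\<close> by (simp add: mult_left_le_one_le)
    finally show ?thesis .
  qed
  interpret scZ: vector_space scZ using Z by (simp add: banach_space_over_def)
  have scY: "scY (of_real r) y = r *\<^sub>R y" and scZ: "scZ (of_real r) z = r *\<^sub>R z"
    and norm_scZ: "norm (scZ c z) = norm c * norm z" for r y c z
    using Y Z by (auto simp: banach_space_over_def)
  have J_add: "blinfun_apply (J (y + y')) z = blinfun_apply (J y) z + blinfun_apply (J y') z"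
    and J_scY: "blinfun_apply (J (scY c y)) z = c * blinfun_apply (J y) z"
    and J_norm: "norm (J y) = norm y"
    and J_range: "range J = bounded_operators scZ (*)" for y y' c z
    using J by (auto simp: dual_identification_def Vector_Spaces.linear_iff)
  have J_scZ: "blinfun_apply (J y) (scZ c z) = c * blinfun_apply (J y) z" for y c z
  proof -
    have "J y \<in> bounded_operators scZ (*)"
      unfolding J_range[symmetric] by (rule rangeI)
    then show ?thesis by (simp add: bounded_operators_def Vector_Spaces.linear_iff)
  qed
  have J_scaleR: "blinfun_apply (J (r *\<^sub>R y)) z = r *\<^sub>R blinfun_apply (J y) z" for r y z
    using J_scY[of "of_real r"] by (simp add: scY scaleR_conv_of_real)
  define pair where "pair y z = re (blinfun_apply (J y) z)" for y z
  have pair_le: "\<bar>pair y z\<bar> \<le> norm y * norm z" for y z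
    using re(2)[of "blinfun_apply (J y) z"] norm_blinfun[of "J y" z]
    by (simp add: pair_def J_norm)
  have bilinear: "bounded_bilinear pair"
  proof (intro bounded_bilinear.intro exI[of _ 1] allI)
    show "norm (pair y z) \<le> norm y * norm z * 1" for y z
      using pair_le by simp
  qed (auto simp: pair_def J_add J_scaleR re.add re.scaleR blinfun.add_right blinfun.scaleR_right)
  have sc_pair: "pair (scY c y) z = pair y (scZ c z)" for c y z
    by (simp add: pair_def J_scY J_scZ)
  have norm_le: "norm y \<le> K" if "0 \<le> K" and K: "\<And>z. pair y z \<le> K * norm z" for y K
  proof -
    have "norm (blinfun_apply (J y) z) \<le> K * norm z" for z
    proof (cases "blinfun_apply (J y) z = 0")
      case False
      \<comment> \<open>The rotation that makes the value at \<open>z\<close> real and positive.\<close>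
      define u where "u = of_real (norm (blinfun_apply (J y) z)) / blinfun_apply (J y) z"
      have "pair y (scZ u z) = norm (blinfun_apply (J y) z)"
        using False by (simp add: pair_def J_scZ u_def re(3))
      moreover have "norm u = 1"
        using False by (simp add: u_def norm_divide)
      ultimately show ?thesis
        using K[of "scZ u z"] by (simp add: norm_scZ)
    qed (use \<open>0 \<le> K\<close> in auto)
    then have "norm (J y) \<le> K"
      using \<open>0 \<le> K\<close> by (intro norm_blinfun_bound) auto
    then show ?thesis by (simp add: J_norm)
  qed
  have represents: "\<exists>y. \<forall>z. pair y z = h z" if "bounded_linear h" for h
  proof -
    interpret h: bounded_linear h by (rule that)
    define H where "H z = of_real (h z) - j * of_real (h (scZ j z))" for z
    obtain K where K: "\<And>z. norm (h z) \<le> norm z * K" "K \<ge> 0"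
      using h.nonneg_bounded by blast
    have scZ_scaleR: "scZ c (r *\<^sub>R z) = r *\<^sub>R scZ c z" for c r z
      by (simp add: mult.commute flip: scZ)
    have H_add: "H (z + z') = H z + H z'" for z z'
      by (simp add: H_def h.add scZ.scale_right_distrib algebra_simps)
    have H_scaleR: "H (r *\<^sub>R z) = r *\<^sub>R H z" for r z
      by (simp add: H_def h.scaleR scZ_scaleR scaleR_conv_of_real algebra_simps)
    have H_j: "H (scZ j z) = j * H z" for z
    proof (cases "j = 0")
      case False
      with re(5) have jj: "j * j = - 1" by simp
      have neg: "scZ (- 1) z = - z" by simp
      show ?thesis
        unfolding H_def scZ.scale_scale jj neg h.neg right_diff_distrib mult.assoc[symmetric]
        by simp
    qed (simp add: H_def)
    have H_scZ: "H (scZ c z) = c * H z" for c z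
    proof -
      have "H (scZ (of_real (re c) - j * of_real (re (j * c))) z) =
          of_real (re c) * H z - j * (of_real (re (j * c)) * H z)"
      proof -
        have "H (a - b) = H a - H b" for a b
          using H_add[of "a - b" b] by simp
        then show ?thesis
          unfolding scZ.scale_left_diff_distrib scZ.scale_scale[symmetric] H_j
          by (simp add: scZ H_scaleR H_j scaleR_conv_of_real)
      qed
      also have "\<dots> = (of_real (re c) - j * of_real (re (j * c))) * H z"
        by (simp add: algebra_simps)
      finally show ?thesis unfolding re(6)[symmetric] .
    qed
    have "bounded_linear H"
    proof (rule bounded_linear_intro[OF H_add H_scaleR])
      fix z
      have "norm (H z) \<le> \<bar>h z\<bar> + norm j * \<bar>h (scZ j z)\<bar>"
        unfolding H_def
        using norm_triangle_ineq4[of "of_real (h z) :: 'k" "j * of_real (h (scZ j z))"]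
        by (simp add: norm_mult)
      also have "\<dots> \<le> norm z * K + norm j * (norm (scZ j z) * K)"
        using K(1) by (intro add_mono mult_left_mono) auto
      finally show "norm (H z) \<le> norm z * (K + norm j * norm j * K)"
        by (simp add: norm_scZ algebra_simps)
    qed
    moreover have "Vector_Spaces.linear scZ (*) H"
      unfolding Vector_Spaces.linear_iff
      using H_add H_scZ scZ.vector_space_axioms vector_space_over_itself.vector_space_axioms by auto
    ultimately have "Blinfun H \<in> range J"
      unfolding J_range bounded_operators_def by (simp add: bounded_linear_Blinfun_apply)
    then obtain y where "J y = Blinfun H" by auto
    then have "pair y z = h z" for z
      using \<open>bounded_linear H\<close>
      by (simp add: pair_def bounded_linear_Blinfun_apply H_def re.diff re(3,4))
    then show ?thesis by blast
  qed
  have weak_star: "weak_star_continuous_on_ball pair B"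
    if "linear B" and B: "continuous_map (subtopology (weak_star_topology J) (cball 0 1))
        (weak_star_topology J) B" for B
    unfolding weak_star_continuous_on_ball_def
  proof (intro allI impI)
    fix z and e :: real
    assume "e > 0"
    let ?V = "{y. norm (blinfun_apply (J y) z) < e}"
    have top: "topspace (weak_star_topology J) = UNIV"
      by (simp add: weak_star_topology_def topspace_pullback_topology
          strong_operator_topology_topspace)
    have J0: "J 0 = 0" using J_norm[of 0] by simp
    have "openin (subtopology (weak_star_topology J) (cball 0 1))
        {y \<in> topspace (subtopology (weak_star_topology J) (cball 0 1)). B y \<in> ?V}"
      by (rule openin_continuous_map_preimage[OF B openin_weak_star_ball])
    then obtain U where U: "openin (weak_star_topology J) U"
      "{y \<in> cball 0 1. B y \<in> ?V} = U \<inter> cball 0 1"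
      by (auto simp: openin_subtopology top)
    have "0 \<in> {y \<in> cball 0 1. B y \<in> ?V}"
      using \<open>e > 0\<close> linear_0[OF \<open>linear B\<close>] by (simp add: J0)
    then have "0 \<in> U" unfolding U(2) by simp
    then obtain W d where W: "finite W" "d > 0"
      "\<And>y. (\<And>w. w \<in> W \<Longrightarrow> norm (blinfun_apply (J y) w) < d) \<Longrightarrow> y \<in> U"
      using openin_weak_star_contains_ball[OF U(1) _ J0] by blast
    show "\<exists>W d. finite W \<and> d > 0 \<and>
        (\<forall>y. norm y \<le> 1 \<longrightarrow> (\<forall>w\<in>W. \<bar>pair y w\<bar> < d) \<longrightarrow> \<bar>pair (B y) z\<bar> < e)"
    proof (intro exI conjI allI impI)
      fix y assume "norm y \<le> 1" and y: "\<forall>w\<in>W \<union> scZ j ` W. \<bar>pair y w\<bar> < d / 2"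
      have "norm (blinfun_apply (J y) w) < d" if "w \<in> W" for w
      proof -
        have "w \<in> W \<union> scZ j ` W" "scZ j w \<in> W \<union> scZ j ` W" using that by auto
        with y have "\<bar>pair y w\<bar> < d / 2" "\<bar>pair y (scZ j w)\<bar> < d / 2" by blast+
        then show ?thesis
          using norm_le_re[of "blinfun_apply (J y) w"] by (simp add: pair_def J_scZ)
      qed
      then have "y \<in> {y \<in> cball 0 1. B y \<in> ?V}"
        using W(3) \<open>norm y \<le> 1\<close> unfolding U(2) by simp
      then show "\<bar>pair (B y) z\<bar> < e"
        using re(2)[of "blinfun_apply (J (B y)) z"] by (simp add: pair_def)
    qed (use W in auto)
  qed
  show ?thesis
  proof (rule that[OF _ sc_pair weak_star])
    show "predual_pairing pair"
      using bilinear pair_le norm_le represents by (rule predual_pairing.intro)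
  qed
qed

section \<open>Function spaces on a semigroup with topology\<close>

lemma continuous_map_weak_topology_on_iff:
  "continuous_map X (weak_topology_on V) h \<longleftrightarrow>
     h ` topspace X \<subseteq> V \<and>
     (\<forall>\<mu>. bounded_linear_on V scaleR scaleR \<mu> \<longrightarrow>
        continuous_map X euclideanreal (\<lambda>x. \<mu> (h x)))"
    (is "?L \<longleftrightarrow> ?R1 \<and> ?R2")
proof -
  let ?S = "{{f \<in> V. \<mu> f \<in> U} | \<mu> U. bounded_linear_on V scaleR scaleR \<mu> \<and> open (U::real set)}"
  have "\<Union> ?S = V"
    using topspace_weak_topology_on[of V]
    unfolding weak_topology_on_def topology_generated_by_topspace .
  then have L_iff: "?L \<longleftrightarrow> (\<forall>U. U \<in> ?S \<longrightarrow> openin X (h -` U \<inter> topspace X)) \<and> ?R1"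
    unfolding weak_topology_on_def continuous_on_generated_topo_iff by simp
  have R2_iff: "(\<forall>U. U \<in> ?S \<longrightarrow> openin X (h -` U \<inter> topspace X)) \<longleftrightarrow> ?R2" if ?R1
  proof -
    have eq: "h -` {f \<in> V. \<mu> f \<in> U} \<inter> topspace X = {x \<in> topspace X. \<mu> (h x) \<in> U}" for \<mu> U
      using that by auto
    have "(\<forall>U. U \<in> ?S \<longrightarrow> openin X (h -` U \<inter> topspace X)) \<longleftrightarrow>
      (\<forall>\<mu> U. bounded_linear_on V scaleR scaleR \<mu> \<and> open (U::real set) \<longrightarrow>
        openin X {x \<in> topspace X. \<mu> (h x) \<in> U})"
      unfolding eq[symmetric] by blast
    also have "\<dots> \<longleftrightarrow> ?R2"
      by (simp add: continuous_map_def imp_conjL)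
    finally show ?thesis .
  qed
  show ?thesis
  proof (cases ?R1)
    case True
    show ?thesis unfolding L_iff R2_iff[OF True] by (simp only: True simp_thms)
  next
    case False
    show ?thesis unfolding L_iff by (simp only: False simp_thms)
  qed
qed

lemma subspace_C_r: "subspace (C_r :: ('s::{semigroup_mult, topological_space} \<Rightarrow>\<^sub>C real) set)"
  by (auto simp: subspace_def C_r_def intro!: continuous_intros)

lemma translate_add:
  assumes "f \<in> C_r" "g \<in> C_r"
  shows "translate (f + g) s = translate f s + translate g s"
  using subspace_add[OF subspace_C_r assms] assms
  by (intro bcontfun_eqI) (simp add: translate_apply)

lemma translate_scaleR:
  assumes "f \<in> C_r"
  shows "translate (c *\<^sub>R f) s = c *\<^sub>R translate f s"
  using subspace_scale[OF subspace_C_r assms] assms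
  by (intro bcontfun_eqI) (simp add: translate_apply)

lemma translate_zero: "translate 0 s = 0"
  by (intro bcontfun_eqI) (simp add: translate_apply subspace_0[OF subspace_C_r])

lemma subspace_C_norm:
  "subspace (C_norm :: ('s::{semigroup_mult, topological_space} \<Rightarrow>\<^sub>C real) set)"
  unfolding subspace_def
proof (intro conjI ballI allI)
  show "(0 :: 's \<Rightarrow>\<^sub>C real) \<in> C_norm"
    by (simp add: C_norm_def translate_zero subspace_0[OF subspace_C_r])
next
  fix f g :: "'s \<Rightarrow>\<^sub>C real" assume fg: "f \<in> C_norm" "g \<in> C_norm"
  then have "f \<in> C_r" "g \<in> C_r" by (simp_all add: C_norm_def)
  then have "translate (f + g) s = translate f s + translate g s" "f + g \<in> C_r" for s
    by (simp_all add: translate_add subspace_add[OF subspace_C_r])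
  then show "f + g \<in> C_norm"
    using fg by (simp add: C_norm_def continuous_on_add)
next
  fix c and f :: "'s \<Rightarrow>\<^sub>C real" assume f: "f \<in> C_norm"
  then have "f \<in> C_r" by (simp add: C_norm_def)
  then have "translate (c *\<^sub>R f) s = c *\<^sub>R translate f s" "c *\<^sub>R f \<in> C_r" for s
    by (simp_all add: translate_scaleR subspace_scale[OF subspace_C_r])
  then show "c *\<^sub>R f \<in> C_norm"
    using f by (simp add: C_norm_def continuous_on_scaleR)
qed

lemma C_weak_iff:
  "f \<in> C_weak \<longleftrightarrow> f \<in> C_r \<and>
     (\<forall>\<mu>. bounded_linear_on C_r scaleR scaleR \<mu> \<longrightarrow>
        continuous_on UNIV (\<lambda>s. \<mu> (translate f s) :: real)) \<and>
     (\<forall>t \<mu>. bounded_linear_on C_r scaleR scaleR \<mu> \<longrightarrow>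
        continuous_on UNIV (\<lambda>s. \<mu> (translate f (s * t)) :: real))"
proof (cases "f \<in> C_r")
  case True
  then have "range (translate f) \<subseteq> C_r" "range (\<lambda>s. translate f (s * t)) \<subseteq> C_r" for t
    using translate_in_C_r by blast+
  with True show ?thesis
    unfolding C_weak_def continuous_map_weak_topology_on_iff by simp
qed (simp add: C_weak_def)

lemma C_weakD:
  fixes \<mu> :: "('s::{semigroup_mult, topological_space} \<Rightarrow>\<^sub>C real) \<Rightarrow> real"
  assumes "f \<in> C_weak" "bounded_linear_on C_r scaleR scaleR \<mu>"
  shows "continuous_on UNIV (\<lambda>s. \<mu> (translate f s))"
    "continuous_on UNIV (\<lambda>s. \<mu> (translate f (s * t)))"
proof -
  note weak = C_weak_iff[THEN iffD1, OF assms(1), THEN conjunct2]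
  show "continuous_on UNIV (\<lambda>s. \<mu> (translate f s))"
    by (rule weak[THEN conjunct1, rule_format, OF assms(2)])
  show "continuous_on UNIV (\<lambda>s. \<mu> (translate f (s * t)))"
    by (rule weak[THEN conjunct2, rule_format, OF assms(2)])
qed

lemma subspace_C_weak:
  "subspace (C_weak :: ('s::{semigroup_mult, topological_space} \<Rightarrow>\<^sub>C real) set)"
  unfolding subspace_def
proof (intro conjI ballI allI)
  show "(0 :: 's \<Rightarrow>\<^sub>C real) \<in> C_weak"
    unfolding C_weak_iff translate_zero
    by (intro conjI allI impI subspace_0[OF subspace_C_r] continuous_on_const)
next
  fix f g :: "'s \<Rightarrow>\<^sub>C real" assume fg: "f \<in> C_weak" "g \<in> C_weak"
  then have C_r: "f \<in> C_r" "g \<in> C_r" by (simp_all add: C_weak_iff)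
  show "f + g \<in> C_weak"
    unfolding C_weak_iff
  proof (intro conjI allI impI subspace_add[OF subspace_C_r C_r])
    fix \<mu> :: "('s \<Rightarrow>\<^sub>C real) \<Rightarrow> real"
    assume \<mu>: "bounded_linear_on C_r scaleR scaleR \<mu>"
    have eq: "\<mu> (translate (f + g) s) = \<mu> (translate f s) + \<mu> (translate g s)" for s
      using \<mu> C_r[THEN translate_in_C_r] unfolding translate_add[OF C_r] bounded_linear_on_def
      by blast
    show "continuous_on UNIV (\<lambda>s. \<mu> (translate (f + g) s))"
      "continuous_on UNIV (\<lambda>s. \<mu> (translate (f + g) (s * t)))" for t
      unfolding eq by (intro continuous_on_add C_weakD[OF _ \<mu>] fg)+
  qed
next
  fix c and f :: "'s \<Rightarrow>\<^sub>C real" assume f: "f \<in> C_weak"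
  then have C_r: "f \<in> C_r" by (simp add: C_weak_iff)
  show "c *\<^sub>R f \<in> C_weak"
    unfolding C_weak_iff
  proof (intro conjI allI impI subspace_scale[OF subspace_C_r C_r])
    fix \<mu> :: "('s \<Rightarrow>\<^sub>C real) \<Rightarrow> real"
    assume \<mu>: "bounded_linear_on C_r scaleR scaleR \<mu>"
    have eq: "\<mu> (translate (c *\<^sub>R f) s) = c *\<^sub>R \<mu> (translate f s)" for s
      using \<mu> translate_in_C_r[OF C_r] unfolding translate_scaleR[OF C_r] bounded_linear_on_def
      by blast
    show "continuous_on UNIV (\<lambda>s. \<mu> (translate (c *\<^sub>R f) s))"
      "continuous_on UNIV (\<lambda>s. \<mu> (translate (c *\<^sub>R f) (s * t)))" for t
      unfolding eq by (intro continuous_on_scaleR continuous_on_const C_weakD[OF _ \<mu>] f)+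
  qed
qed

lemma mean_on_bounded_linear_on:
  assumes "mean_on F \<phi>"
  shows "bounded_linear_on F scaleR scaleR \<phi>"
proof -
  have "norm (\<phi> f) \<le> 1 * norm f" if "f \<in> F" for f
  proof -
    have f: "\<bar>apply_bcontfun f s\<bar> \<le> norm f" for s
      using norm_bounded[of f s] by simp
    then have "apply_bcontfun f s \<le> norm f" "- norm f \<le> apply_bcontfun f s" for s
      by (smt (verit))+
    then have "Sup (range (apply_bcontfun f)) \<le> norm f" "- norm f \<le> Inf (range (apply_bcontfun f))"
      by (auto intro!: cSup_least cInf_greatest)
    then show ?thesis
      using assms that unfolding mean_on_def by (smt (verit) real_norm_def)
  qed
  then show ?thesis
    using assms unfolding mean_on_def bounded_linear_on_def by (metis real_scaleR_def)
qed

lemma mean_on_const: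
  assumes "mean_on F \<phi>" "f \<in> F" "\<And>s. apply_bcontfun f s = c"
  shows "\<phi> f = c"
proof -
  have "range (apply_bcontfun f) = {c}" using assms(3) by auto
  then show ?thesis using assms(1,2) by (force simp: mean_on_def)
qed

lemma locally_bounded_Bfun:
  assumes "locally_bounded (\<lambda>s. norm (D s))"
  shows "Bfun D (at s)"
proof -
  obtain U where U: "open U" "s \<in> U" "bounded ((\<lambda>t. norm (D t)) ` U)"
    using assms unfolding locally_bounded_def by blast
  obtain K where "\<forall>r \<in> (\<lambda>t. norm (D t)) ` U. norm r \<le> K"
    using U(3) unfolding bounded_iff by blast
  then have "norm (D t) \<le> K" if "t \<in> U" for t
    using that by simp
  with U(1,2) have "eventually (\<lambda>t. norm (D t) \<le> K) (at s)"
    unfolding eventually_at_topological by blast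
  then show ?thesis by (rule BfunI)
qed

section \<open>The orbit of an operator under conjugation\<close>

text \<open>
  A bounded operator \<open>T'\<close> whose conjugates \<open>D\<^sub>s T' A\<^sub>s\<close> are bounded by \<open>M\<close>, where
  \<open>D\<^sub>s = B\<^sub>s\<inverse>\<close>. The continuity assumptions are those
  common to both versions of the theorem.
\<close>

locale conjugated_orbit = predual_pairing pair
  for pair :: "'y::real_normed_vector \<Rightarrow> 'z::real_normed_vector \<Rightarrow> real" +
  fixes A :: "'s::{semigroup_mult, topological_space} \<Rightarrow> ('x::real_normed_vector \<Rightarrow>\<^sub>L 'x)"
    and B D :: "'s \<Rightarrow> ('y \<Rightarrow>\<^sub>L 'y)" and T' :: "'x \<Rightarrow>\<^sub>L 'y" and M :: real
  assumes A_hom: "operator_homomorphism A" and B_hom: "operator_homomorphism B"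
    and D_B [simp]: "\<And>s y. blinfun_apply (D s) (blinfun_apply (B s) y) = y"
    and B_D [simp]: "\<And>s y. blinfun_apply (B s) (blinfun_apply (D s) y) = y"
    and A_continuous: "\<And>x. continuous_on UNIV (\<lambda>s. blinfun_apply (A s) x)"
    and B_continuous: "\<And>y. continuous_on UNIV (\<lambda>s. blinfun_apply (B s) y)"
    and D_locally_bounded: "locally_bounded (\<lambda>s. norm (D s))"
    and orbit_norm_le: "\<And>s. norm (D s o\<^sub>L T' o\<^sub>L A s) \<le> M"
    and B_weak_star: "\<And>s. weak_star_continuous_on_ball pair (blinfun_apply (B s))"
begin

definition orbit :: "'s \<Rightarrow> 'x \<Rightarrow>\<^sub>L 'y" where
  "orbit s = D s o\<^sub>L T' o\<^sub>L A s"

lemma A_mult: "blinfun_apply (A (s * t)) x = blinfun_apply (A s) (blinfun_apply (A t) x)"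
  using A_hom by (simp add: operator_homomorphism_def)

lemma D_mult: "blinfun_apply (D (s * t)) y = blinfun_apply (D t) (blinfun_apply (D s) y)"
proof -
  have "blinfun_apply (B (s * t)) (blinfun_apply (D t) (blinfun_apply (D s) y)) = y"
    using B_hom by (simp add: operator_homomorphism_def)
  then show ?thesis by (metis D_B)
qed

lemma orbit_mult:
  "blinfun_apply (orbit (s * t)) x =
     blinfun_apply (D t) (blinfun_apply (orbit s) (blinfun_apply (A t) x))"
  by (simp add: orbit_def A_mult D_mult)

lemma orbit_bound: "norm (blinfun_apply (orbit s) x) \<le> M * norm x"
  using norm_blinfun[of "orbit s" x] mult_right_mono[OF orbit_norm_le[of s] norm_ge_zero[of x]]
  by (simp add: orbit_def)

text \<open>
  Strong continuity passes to the inverses, since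
  \<open>D\<^sub>s y\<^sub>s - D\<^sub>s\<^sub>0 y\<^sub>s\<^sub>0 = D\<^sub>s (y\<^sub>s - B\<^sub>s D\<^sub>s\<^sub>0 y\<^sub>s\<^sub>0)\<close> is a locally bounded factor applied to a
  null function.
\<close>

lemma continuous_on_D:
  assumes "continuous_on UNIV y"
  shows "continuous_on UNIV (\<lambda>s. blinfun_apply (D s) (y s))"
  unfolding continuous_on_def
proof
  fix s0
  let ?v = "\<lambda>s. y s - blinfun_apply (B s) (blinfun_apply (D s0) (y s0))"
  have "(?v \<longlongrightarrow> ?v s0) (at s0)"
    using assms B_continuous unfolding continuous_on_def by (intro tendsto_diff) blast+
  then have "Zfun ?v (at s0)"
    by (simp add: tendsto_Zfun_iff)
  then have "Zfun (\<lambda>s. blinfun_apply (D s) (?v s)) (at s0)"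
    by (rule bounded_bilinear.Bfun_prod_Zfun[OF bounded_bilinear_blinfun_apply
          locally_bounded_Bfun[OF D_locally_bounded]])
  then show "((\<lambda>s. blinfun_apply (D s) (y s)) \<longlongrightarrow> blinfun_apply (D s0) (y s0)) (at s0)"
    by (simp add: tendsto_Zfun_iff blinfun.diff_right)
qed

text \<open>
  The same argument in the operator norm, with \<open>D\<^sub>s - D\<^sub>s\<^sub>0 = D\<^sub>s (B\<^sub>s\<^sub>0 - B\<^sub>s) D\<^sub>s\<^sub>0\<close>.
\<close>

lemma continuous_on_D_norm:
  assumes "continuous_on UNIV B"
  shows "continuous_on UNIV D"
  unfolding continuous_on_def
proof
  fix s0
  let ?v = "\<lambda>s. (B s0 - B s) o\<^sub>L D s0"
  have "(?v \<longlongrightarrow> ?v s0) (at s0)"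
    using assms by (intro tendsto_intros) (auto simp: continuous_on_def)
  then have "Zfun ?v (at s0)"
    by (simp add: tendsto_Zfun_iff)
  then have "Zfun (\<lambda>s. D s o\<^sub>L ?v s) (at s0)"
    by (rule bounded_bilinear.Bfun_prod_Zfun[OF bounded_bilinear_blinfun_compose
          locally_bounded_Bfun[OF D_locally_bounded]])
  moreover have "D s o\<^sub>L ?v s = D s - D s0" for s
    by (rule blinfun_eqI) (simp add: blinfun.diff_left blinfun.diff_right)
  ultimately show "(D \<longlongrightarrow> D s0) (at s0)"
    by (simp add: tendsto_Zfun_iff)
qed

lemma continuous_on_orbit: "continuous_on UNIV (\<lambda>s. blinfun_apply (orbit s) x)"
  unfolding orbit_def
  using A_continuous[of x] by (auto intro!: continuous_on_D continuous_intros)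

definition matrix_element :: "'x \<Rightarrow> 'z \<Rightarrow> ('s \<Rightarrow>\<^sub>C real)" where
  "matrix_element x z = Bcontfun (\<lambda>s. pair (blinfun_apply (orbit s) x) z)"

lemma matrix_element_apply:
  "apply_bcontfun (matrix_element x z) s = pair (blinfun_apply (orbit s) x) z"
proof -
  have "norm (pair (blinfun_apply (orbit s) x) z) \<le> M * norm x * norm z" for s
    unfolding real_norm_def
    by (intro order_trans[OF pair_le] mult_right_mono orbit_bound norm_ge_zero)
  then have "(\<lambda>s. pair (blinfun_apply (orbit s) x) z) \<in> bcontfun"
    by (intro bcontfun_normI bounded_linear.continuous_on[OF pair.bounded_linear_left]
        continuous_on_orbit)
  then show ?thesis by (simp add: matrix_element_def Bcontfun_inverse)
qed

lemma matrix_element_in_C_r: "matrix_element x z \<in> C_r"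
  unfolding C_r_def
  by (simp add: matrix_element_apply orbit_mult continuous_on_orbit
      bounded_linear.continuous_on[OF pair.bounded_linear_left]
      bounded_linear.continuous_on[OF blinfun.bounded_linear_right])

lemma translate_matrix_element_apply:
  "apply_bcontfun (translate (matrix_element x z) t) s =
     pair (blinfun_apply (D t) (blinfun_apply (orbit s) (blinfun_apply (A t) x))) z"
  by (simp add: translate_apply[OF matrix_element_in_C_r] matrix_element_apply orbit_mult)

lemma averaged_operator:
  assumes V: "\<And>x z. matrix_element x z \<in> V" and \<mu>: "bounded_linear_on V scaleR scaleR \<mu>"
  obtains I where "bounded_linear I" "\<And>x z. pair (I x) z = \<mu> (matrix_element x z)"
proof -
  obtain N where N: "N \<ge> 0" "\<And>f. f \<in> V \<Longrightarrow> norm (\<mu> f) \<le> N * norm f"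
    using bounded_linear_on_bound[OF \<mu>] by blast
  have "\<exists>y. norm y \<le> N * (M * norm x) \<and> (\<forall>z. pair y z = \<mu> (matrix_element x z))" for x
    by (rule weak_star_integral[OF \<mu> N orbit_bound V matrix_element_apply]) blast+
  then obtain I where I: "\<And>x. norm (I x) \<le> N * (M * norm x)"
    "\<And>x z. pair (I x) z = \<mu> (matrix_element x z)"
    by metis
  have "matrix_element (x + x') z = matrix_element x z + matrix_element x' z"
    "matrix_element (r *\<^sub>R x) z = r *\<^sub>R matrix_element x z" for x x' z r
    by (rule bcontfun_eqI; simp add: matrix_element_apply pair.add_left pair.scaleR_left
        blinfun.add_right blinfun.scaleR_right)+
  then have "I (x + x') = I x + I x'" "I (r *\<^sub>R x) = r *\<^sub>R I x" for x x' r
    using \<mu> V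
    by (auto intro!: pair_separates simp: I(2) pair.add_left pair.scaleR_left bounded_linear_on_def)
  then have "bounded_linear I"
    using I(1) by (intro bounded_linear_intro[of _ "N * M"]) (auto simp: mult_ac)
  then show ?thesis using I(2) by (rule that)
qed

text \<open>
  The translate by \<open>t\<close> is the matrix element of the orbit \<open>s \<mapsto> G\<^sub>s\<^sub>t x\<close>. Let \<open>y\<close> be the integral
  of this orbit. Since \<open>B\<^sub>t G\<^sub>s\<^sub>t x = G\<^sub>s A\<^sub>t x\<close> and \<open>B\<^sub>t\<close> commutes with the integral, \<open>B\<^sub>t y = I A\<^sub>t x\<close>.
\<close>

lemma averaged_operator_translate:
  assumes "subspace V" "right_invariant_space V"
    and V: "\<And>x z. matrix_element x z \<in> V" and \<mu>: "bounded_linear_on V scaleR scaleR \<mu>"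
    and I: "\<And>x z. pair (I x) z = \<mu> (matrix_element x z)"
  shows "\<mu> (translate (matrix_element x z) t) =
    pair (blinfun_apply (D t) (I (blinfun_apply (A t) x))) z"
proof -
  obtain N where N: "N \<ge> 0" "\<And>f. f \<in> V \<Longrightarrow> norm (\<mu> f) \<le> N * norm f"
    using bounded_linear_on_bound[OF \<mu>] by blast
  have t_V: "translate (matrix_element x w) t \<in> V" for w
    using assms(2) V by (simp add: right_invariant_space_def)
  have t_apply: "apply_bcontfun (translate (matrix_element x w) t) s =
      pair (blinfun_apply (orbit (s * t)) x) w" for w s
    by (simp add: translate_matrix_element_apply orbit_mult)
  have t_bound: "norm (blinfun_apply (orbit (s * t)) x) \<le> M * norm x" for s
    by (rule orbit_bound)
  obtain y where y: "\<And>w. pair y w = \<mu> (translate (matrix_element x w) t)"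
    using weak_star_integral[OF \<mu> N t_bound t_V t_apply] by blast
  have "blinfun_apply (B t) y = I (blinfun_apply (A t) x)"
    by (rule weak_star_integral_commutes[OF assms(1) \<mu> t_bound B_weak_star
          blinfun.bounded_linear_right t_V t_apply V _ y[symmetric] I[symmetric]])
      (simp add: matrix_element_apply orbit_mult)
  then show ?thesis
    unfolding y[symmetric] by (metis D_B)
qed

text \<open>
  By the preceding lemma, \<open>\<mu>\<close> maps the translate by \<open>s\<close> to \<open>\<langle>D\<^sub>s I A\<^sub>s x, z\<rangle>\<close>, where \<open>s\<close>
  occurs only in operators that are applied to vectors, so that strong continuity suffices.
\<close>

lemma matrix_element_in_C_weak: "matrix_element x z \<in> C_weak"
  unfolding C_weak_iff
proof (intro conjI allI impI matrix_element_in_C_r)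
  fix \<mu> :: "('s \<Rightarrow>\<^sub>C real) \<Rightarrow> real"
  assume \<mu>: "bounded_linear_on C_r scaleR scaleR \<mu>"
  obtain I where I: "bounded_linear I" "\<And>x z. pair (I x) z = \<mu> (matrix_element x z)"
    using averaged_operator[OF matrix_element_in_C_r \<mu>] by blast
  have "right_invariant_space (C_r :: ('s \<Rightarrow>\<^sub>C real) set)"
    by (simp add: right_invariant_space_def translate_in_C_r)
  note translate = averaged_operator_translate[OF subspace_C_r this matrix_element_in_C_r \<mu> I(2)]
  have "continuous_on UNIV (\<lambda>s. blinfun_apply (D s) (I (blinfun_apply (A s) x)))" for x
    using A_continuous by (intro continuous_on_D bounded_linear.continuous_on[OF I(1)])
  then show "continuous_on UNIV (\<lambda>s. \<mu> (translate (matrix_element x z) s))"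
    "continuous_on UNIV (\<lambda>s. \<mu> (translate (matrix_element x z) (s * t)))" for t
    unfolding translate A_mult D_mult
    by (simp_all add: bounded_linear.continuous_on[OF pair.bounded_linear_left]
        bounded_linear.continuous_on[OF blinfun.bounded_linear_right])
qed

text \<open>
  The functions \<open>h s\<close> are bounded bilinear in \<open>P s\<close> and \<open>u s\<close>, uniformly in the orbit.
\<close>

lemma continuous_on_matrix_element_norm:
  assumes P: "continuous_on UNIV P" and u: "continuous_on UNIV u"
    and h: "\<And>s r. apply_bcontfun (h s) r =
      pair (blinfun_apply (P s) (blinfun_apply (orbit r) (u s))) z"
  shows "continuous_on UNIV (h :: 's \<Rightarrow> ('s \<Rightarrow>\<^sub>C real))"
  unfolding continuous_on_def
proof
  fix s0
  define b where "b s = (norm (P s - P s0) * (M * norm (u s)) +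
    norm (P s0) * (M * norm (u s - u s0))) * norm z" for s
  have h_le: "norm (h s - h s0) \<le> b s" for s
  proof (rule norm_bound)
    fix r
    let ?a = "blinfun_apply (P s - P s0) (blinfun_apply (orbit r) (u s))"
    let ?b = "blinfun_apply (P s0) (blinfun_apply (orbit r) (u s - u s0))"
    have "norm (apply_bcontfun (h s - h s0) r) = norm (pair (?a + ?b) z)"
      by (simp add: h pair.add_left pair.diff_left blinfun.diff_left blinfun.diff_right)
    also have "\<dots> \<le> norm (?a + ?b) * norm z"
      using pair_le by simp
    also have "\<dots> \<le> b s"
      unfolding b_def
      by (intro mult_right_mono norm_triangle_le add_mono order_trans[OF norm_blinfun]
          mult_left_mono orbit_bound) auto
    finally show "norm (apply_bcontfun (h s - h s0) r) \<le> b s" .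
  qed
  have "(b \<longlongrightarrow> b s0) (at s0)"
    unfolding b_def using P u by (intro tendsto_intros) (auto simp: continuous_on_def)
  then have "(b \<longlongrightarrow> 0) (at s0)" by (simp add: b_def)
  then have "((\<lambda>s. h s - h s0) \<longlongrightarrow> 0) (at s0)"
    by (rule Lim_null_comparison[OF always_eventually[OF allI[OF h_le]]])
  then show "(h \<longlongrightarrow> h s0) (at s0)" by (rule LIM_zero_cancel)
qed

lemma matrix_element_in_C_norm:
  assumes "continuous_on UNIV B"
  shows "matrix_element x z \<in> C_norm"
proof -
  note D = continuous_on_D_norm[OF assms]
  have "continuous_on UNIV (\<lambda>s. translate (matrix_element x z) s)"
    by (rule continuous_on_matrix_element_norm[OF D A_continuous])
      (rule translate_matrix_element_apply)
  moreover have "continuous_on UNIV (\<lambda>s. translate (matrix_element x z) (s * t))" for t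
  proof (rule continuous_on_matrix_element_norm)
    show "continuous_on UNIV (\<lambda>s. D t o\<^sub>L D s)"
      using D by (intro bounded_bilinear.continuous_on[OF bounded_bilinear_blinfun_compose]
          continuous_intros)
    show "continuous_on UNIV (\<lambda>s. blinfun_apply (A s) (blinfun_apply (A t) x))"
      by (rule A_continuous)
  qed (simp add: translate_matrix_element_apply A_mult D_mult)
  ultimately show ?thesis
    by (simp add: C_norm_def matrix_element_in_C_r)
qed

text \<open>
  For the invariant mean, \<open>averaged_operator_translate\<close> says that \<open>D\<^sub>s T A\<^sub>s = T\<close>.
\<close>

lemma averaged_intertwiner:
  assumes "subspace V" "right_invariant_space V" "right_invariant_mean_on V \<phi>"
    and V: "\<And>x z. matrix_element x z \<in> V"
  obtains T where "bounded_linear T" "\<And>x z. pair (T x) z = \<phi> (matrix_element x z)"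
    "\<And>s x. blinfun_apply (B s) (T x) = T (blinfun_apply (A s) x)"
proof -
  have \<phi>: "bounded_linear_on V scaleR scaleR \<phi>"
    using assms(3) by (simp add: right_invariant_mean_on_def mean_on_bounded_linear_on)
  obtain T where T: "bounded_linear T" "\<And>x z. pair (T x) z = \<phi> (matrix_element x z)"
    using averaged_operator[OF V \<phi>] by blast
  have "blinfun_apply (D s) (T (blinfun_apply (A s) x)) = T x" for s x
  proof (rule pair_separates)
    fix z
    show "pair (blinfun_apply (D s) (T (blinfun_apply (A s) x))) z = pair (T x) z"
      using assms(3) V
      by (simp add: T(2) right_invariant_mean_on_def
          flip: averaged_operator_translate[OF assms(1,2) V \<phi> T(2)])
  qed
  then have "blinfun_apply (B s) (T x) = T (blinfun_apply (A s) x)" for s x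
    by (metis B_D)
  with T show ?thesis by (rule that)
qed

end

section \<open>Extension of intertwining operators\<close>

theorem theorem4p10:
  fixes scX :: "'k::real_or_complex \<Rightarrow> 'x::banach \<Rightarrow> 'x"
    and scY :: "'k \<Rightarrow> 'y::banach \<Rightarrow> 'y"
    and scZ :: "'k \<Rightarrow> 'z::banach \<Rightarrow> 'z"
    and J :: "'y \<Rightarrow> ('z \<Rightarrow>\<^sub>L 'k)"
    and A :: "'s::{semigroup_mult, topological_space} \<Rightarrow> ('x \<Rightarrow>\<^sub>L 'x)"
    and B :: "'s \<Rightarrow> ('y \<Rightarrow>\<^sub>L 'y)"
    and E :: "'x set"
    and T0 :: "'x \<Rightarrow> 'y"
  assumes X: "banach_space_over scX"
    and Y: "banach_space_over scY"
    and A: "\<And>s. A s \<in> bounded_operators scX scX" "operator_homomorphism A"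
    and B: "\<And>s. B s \<in> bounded_operators scY scY" "operator_homomorphism B"
    and E: "module.subspace scX E" "closed E"
    and T0: "bounded_linear_on E scX scY T0"
    and i0:
      "(strongly_right_amenable TYPE('s) \<and>
          continuous_map euclidean strong_operator_topology A \<and>
          continuous_map euclidean strong_operator_topology B) \<or>
       (weakly_right_amenable TYPE('s) \<and>
          continuous_on UNIV A \<and>
          continuous_on UNIV B)"
    and i1: "\<And>s. blinfun_apply (A s) ` E \<subseteq> E" "\<And>s. isomorphism (B s)"
    and i2: "banach_space_over scZ" "dual_identification scY scZ J"
    and i3: "\<And>s. continuous_map (subtopology (weak_star_topology J) (cball 0 1))
                   (weak_star_topology J) (blinfun_apply (B s))"
    and i4: "locally_bounded (\<lambda>s. norm (inverse_operator (B s)))"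
    and i5: "\<And>s x. x \<in> E \<Longrightarrow> blinfun_apply (B s) (T0 x) = T0 (blinfun_apply (A s) x)"
  shows
    "(\<exists>T \<in> bounded_operators scX scY.
        (\<forall>x\<in>E. blinfun_apply T x = T0 x) \<and> (\<forall>s. B s o\<^sub>L T = T o\<^sub>L A s)) \<longleftrightarrow>
     (\<exists>T' \<in> bounded_operators scX scY.
        (\<forall>x\<in>E. blinfun_apply T' x = T0 x) \<and>
        bdd_above (range (\<lambda>s. norm (inverse_operator (B s) o\<^sub>L T' o\<^sub>L A s))))"
proof
  assume "\<exists>T \<in> bounded_operators scX scY.
    (\<forall>x\<in>E. blinfun_apply T x = T0 x) \<and> (\<forall>s. B s o\<^sub>L T = T o\<^sub>L A s)"
  then obtain T where T: "T \<in> bounded_operators scX scY" "\<forall>x\<in>E. blinfun_apply T x = T0 x"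
    "\<And>s. B s o\<^sub>L T = T o\<^sub>L A s"
    by blast
  have "inverse_operator (B s) o\<^sub>L T o\<^sub>L A s = T" for s
  proof (rule blinfun_eqI)
    fix x
    have "blinfun_apply T (blinfun_apply (A s) x) = blinfun_apply (B s) (blinfun_apply T x)"
      using T(3)[of s] by (metis blinfun_apply_blinfun_compose)
    then show "blinfun_apply (inverse_operator (B s) o\<^sub>L T o\<^sub>L A s) x = blinfun_apply T x"
      using i1(2)[of s]
      by (simp add: inverse_operator_apply isomorphism_def bij_is_inj)
  qed
  then show "\<exists>T' \<in> bounded_operators scX scY.
      (\<forall>x\<in>E. blinfun_apply T' x = T0 x) \<and>
      bdd_above (range (\<lambda>s. norm (inverse_operator (B s) o\<^sub>L T' o\<^sub>L A s)))"
    using T(1,2) by (intro bexI[of _ T]) auto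
next
  assume "\<exists>T' \<in> bounded_operators scX scY.
    (\<forall>x\<in>E. blinfun_apply T' x = T0 x) \<and>
    bdd_above (range (\<lambda>s. norm (inverse_operator (B s) o\<^sub>L T' o\<^sub>L A s)))"
  then obtain T' M where T': "T' \<in> bounded_operators scX scY"
    "\<And>x. x \<in> E \<Longrightarrow> blinfun_apply T' x = T0 x"
    and M: "\<And>s. norm (inverse_operator (B s) o\<^sub>L T' o\<^sub>L A s) \<le> M"
    by (auto simp: bdd_above_def)
  obtain pair where pair: "predual_pairing pair"
    "\<And>c y z. pair (scY c y) z = pair y (scZ c z)"
    "\<And>B. linear B \<Longrightarrow> continuous_map (subtopology (weak_star_topology J) (cball 0 1))
        (weak_star_topology J) B \<Longrightarrow> weak_star_continuous_on_ball pair B"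
    using dual_identification_pairing[OF Y i2] by blast
  interpret predual_pairing pair by (rule pair(1))
  define D where "D s = inverse_operator (B s)" for s
  have A_SOT: "continuous_on UNIV (\<lambda>s. blinfun_apply (A s) x)"
    and B_SOT: "continuous_on UNIV (\<lambda>s. blinfun_apply (B s) y)" for x y
    using i0
    by (auto simp: continuous_on_strong_operator_topo_iff_coordinatewise
        intro: bounded_bilinear.continuous_on[OF bounded_bilinear_blinfun_apply]
          continuous_on_const)
  interpret conjugated_orbit pair A B D T' M
  proof unfold_locales
    fix s y
    show "blinfun_apply (D s) (blinfun_apply (B s) y) = y"
      "blinfun_apply (B s) (blinfun_apply (D s) y) = y"
      using i1(2)[of s]
      by (simp_all add: D_def inverse_operator_apply isomorphism_def bij_is_inj bij_is_surj
          surj_f_inv_f)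
    show "weak_star_continuous_on_ball pair (blinfun_apply (B s))"
      by (rule pair(3)[OF _ i3]) (rule bounded_linear.linear[OF blinfun.bounded_linear_right])
  qed (use A(2) B(2) A_SOT B_SOT i4 M in \<open>simp_all add: D_def\<close>)
  obtain V \<phi> where V: "subspace V" "right_invariant_space V" "right_invariant_mean_on V \<phi>"
    "\<And>x z. matrix_element x z \<in> V"
    using i0 unfolding strongly_right_amenable_def weakly_right_amenable_def
    by (metis subspace_C_weak right_invariant_C_weak matrix_element_in_C_weak
        subspace_C_norm right_invariant_C_norm matrix_element_in_C_norm)
  obtain T where T: "bounded_linear T" "\<And>x z. pair (T x) z = \<phi> (matrix_element x z)"
    "\<And>s x. blinfun_apply (B s) (T x) = T (blinfun_apply (A s) x)"
    using averaged_intertwiner[OF V] by blast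
  have T_extends: "T x = T0 x" if "x \<in> E" for x
  proof (rule pair_separates)
    fix z
    have "blinfun_apply (orbit s) x = T0 x" for s
    proof -
      have "blinfun_apply (A s) x \<in> E" using i1(1)[of s] that by auto
      then have "blinfun_apply (orbit s) x = blinfun_apply (D s) (blinfun_apply (B s) (T0 x))"
        by (simp add: orbit_def T'(2) i5[OF that])
      then show ?thesis by simp
    qed
    then have "\<phi> (matrix_element x z) = pair (T0 x) z"
      by (intro mean_on_const[OF V(3)[unfolded right_invariant_mean_on_def, THEN conjunct1] V(4)])
        (simp add: matrix_element_apply)
    then show "pair (T x) z = pair (T0 x) z" by (simp add: T(2))
  qed
  have sc: "blinfun_apply (A s) (scX c x) = scX c (blinfun_apply (A s) x)"
    "blinfun_apply (B s) (scY c y) = scY c (blinfun_apply (B s) y)"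
    "blinfun_apply T' (scX c x) = scY c (blinfun_apply T' x)" for s c x y
    using A(1)[of s] B(1)[of s] T'(1)
    by (simp_all add: bounded_operators_def Vector_Spaces.linear_iff)
  have D_sc: "blinfun_apply (D s) (scY c y) = scY c (blinfun_apply (D s) y)" for s c y
    by (metis sc(2) D_B B_D)
  have T_sc: "T (scX c x) = scY c (T x)" for c x
  proof (rule pair_separates)
    fix z
    have "matrix_element (scX c x) z = matrix_element x (scZ c z)"
      by (rule bcontfun_eqI) (simp add: matrix_element_apply orbit_def sc D_sc pair(2))
    then show "pair (T (scX c x)) z = pair (scY c (T x)) z"
      by (simp add: T(2) pair(2))
  qed
  have "Blinfun T \<in> bounded_operators scX scY"
    using X Y T(1) T_sc
    by (simp add: bounded_operators_def bounded_linear_Blinfun_apply Vector_Spaces.linear_iff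
        banach_space_over_def linear_add[OF bounded_linear.linear])
  moreover have "B s o\<^sub>L Blinfun T = Blinfun T o\<^sub>L A s" for s
    by (rule blinfun_eqI) (simp add: bounded_linear_Blinfun_apply[OF T(1)] T(3))
  ultimately show "\<exists>T \<in> bounded_operators scX scY.
      (\<forall>x\<in>E. blinfun_apply T x = T0 x) \<and> (\<forall>s. B s o\<^sub>L T = T o\<^sub>L A s)"
    using T_extends by (intro bexI[of _ "Blinfun T"]) (auto simp: bounded_linear_Blinfun_apply[OF T(1)])
qed

end
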